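(* Let $I$ be a finite set, fix non-zero complex numbers $\beta_i$, $i\in I$, and let $\mathbb P$ be a Bernoulli measure on $\Omega=I^{\mathbb N}$. Then there exists a Borel set $\mathcal G\subset\Omega\times\mathbb D$ such that: (i) for $\mathbb P$-a.e. $\omega\in\Omega$, $\dim_H\{\lambda\in\mathbb D_*:(\omega,\lambda)\notin\mathcal G\}\le1$; (ii) if $(\omega,\lambda)\in\mathcal G$ and $\Sigma=((\Phi^{(i)})_{i\in I},(p_i)_{i\in I},\mathbb P)$ is any non-degenerate planar model with selection measure $\mathbb P$ such that the linear part of the maps in $\Phi^{(i)}$ is $\lambda^{\beta_i}$ with $|\lambda^{\beta_i}|<1$ for each $i$, then $\eta^{(\omega)}\in\mathcal D_2$.
   Context: $\mathbb D$ is the open unit disc, $\mathbb D_*=\mathbb D\setminus\{0\}$; $\lambda^\beta:=e^{\beta\log\lambda}$ with $\log$ the principal branch (imaginary part in $(-\pi,\pi]$). A planar model $\Sigma=((\Phi^{(i)})_{i\in I},(p_i)_{i\in I},\mathbb P)$: for each $i\in I$, $\Phi^{(i)}=(f^{(i)}_1,\dots,f^{(i)}_{k_i})$ with $f^{(i)}_j(z)=\lambda_i z+t^{(i)}_j$, $0<|\lambda_i|<1$; $p_i$ a probability vector with positive entries; $\mathbb P$ a probability on $\Omega=I^{\mathbb N}$. The random measure $\eta^{(\omega)}$ is the law of $\sum_{n\ge1}(\prod_{j=1}^{n-1}\lambda_{\omega_j})t^{(\omega_n)}_{u_n}$ with $u_n\in\{1,\dots,k_{\omega_n}\}$ independent with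 laws $p_{\omega_n}$. The model is non-degenerate if there is $i_0$ with $\mathbb P(\omega_1=i_0)>0$ and not all maps in $\Phi^{(i_0)}$ equal. Fourier transform $\widehat\mu(\xi)=\int e^{2\pi i\,\mathrm{Re}(z\bar\xi)}d\mu(z)$; $\mathcal D_2(\sigma)=\{\mu:|\widehat\mu(\xi)|=O_\mu(|\xi|^{-\sigma})\}$, $\mathcal D_2=\bigcup_{\sigma>0}\mathcal D_2(\sigma)$. *)

theory Defs
  imports "HOL-Probability.Probability"
begin

definition hausdorff_pre :: "real \<Rightarrow> real \<Rightarrow> 'a::metric_space set \<Rightarrow> ennreal" where
  "hausdorff_pre s \<delta> A =
     (INF C \<in> {C :: nat \<Rightarrow> 'a set. A \<subseteq> (\<Union>n. C n) \<and> (\<forall>n. bounded (C n) \<and> diameter (C n) \<le> \<delta>)}.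
        (\<Sum>n. ennreal (diameter (C n) powr s)))"

definition hausdorff_measure :: "real \<Rightarrow> 'a::metric_space set \<Rightarrow> ennreal" where
  "hausdorff_measure s A = (SUP \<delta> \<in> {0<..}. hausdorff_pre s \<delta> A)"

definition hausdorff_dim :: "'a::metric_space set \<Rightarrow> ereal" where
  "hausdorff_dim A = (INF s \<in> {s::real. 0 \<le> s \<and> hausdorff_measure s A = 0}. ereal s)"

text \<open>Omega = I^N with the product (= Borel) sigma-algebra, I a finite type.\<close>
definition Omega_space :: "(nat \<Rightarrow> 'i) measure" where
  "Omega_space = PiM UNIV (\<lambda>_::nat. count_space (UNIV :: 'i set))"

definition bernoulli_measure :: "'i pmf \<Rightarrow> (nat \<Rightarrow> 'i) measure" where
  "bernoulli_measure q = PiM UNIV (\<lambda>_::nat. measure_pmf q)"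

text \<open>A planar model: for each i, k i maps z \<mapsto> lam i * z + t i j (j < k i, indices from 0),
  probability weights p i j > 0 summing to one, and 0 < |lam i| < 1.\<close>
definition planar_model ::
  "('i \<Rightarrow> nat) \<Rightarrow> ('i \<Rightarrow> nat \<Rightarrow> complex) \<Rightarrow> ('i \<Rightarrow> nat \<Rightarrow> real) \<Rightarrow> ('i \<Rightarrow> complex) \<Rightarrow> bool" where
  "planar_model k t p lam \<longleftrightarrow>
     (\<forall>i. 1 \<le> k i \<and> (\<forall>j<k i. 0 < p i j) \<and> (\<Sum>j<k i. p i j) = 1 \<and>
          0 < cmod (lam i) \<and> cmod (lam i) < 1)"

definition nondegenerate ::
  "(nat \<Rightarrow> 'i) measure \<Rightarrow> ('i \<Rightarrow> nat) \<Rightarrow> ('i \<Rightarrow> nat \<Rightarrow> complex) \<Rightarrow> bool" where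
  "nondegenerate P k t \<longleftrightarrow>
     (\<exists>i0. 0 < measure P {\<omega> \<in> space P. \<omega> 0 = i0} \<and>
           (\<exists>j1<k i0. \<exists>j2<k i0. t i0 j1 \<noteq> t i0 j2))"

definition digit_measure :: "nat \<Rightarrow> (nat \<Rightarrow> real) \<Rightarrow> nat measure" where
  "digit_measure m w = density (count_space UNIV) (\<lambda>j. if j < m then ennreal (w j) else 0)"

definition eta ::
  "('i \<Rightarrow> nat) \<Rightarrow> ('i \<Rightarrow> nat \<Rightarrow> complex) \<Rightarrow> ('i \<Rightarrow> nat \<Rightarrow> real) \<Rightarrow> ('i \<Rightarrow> complex)
     \<Rightarrow> (nat \<Rightarrow> 'i) \<Rightarrow> complex measure" where
  "eta k t p lam \<omega> =
     distr (PiM UNIV (\<lambda>n. digit_measure (k (\<omega> n)) (p (\<omega> n)))) borel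
       (\<lambda>u. \<Sum>n. (\<Prod>j<n. lam (\<omega> j)) * t (\<omega> n) (u n))"

definition fourier_transform :: "complex measure \<Rightarrow> complex \<Rightarrow> complex" where
  "fourier_transform \<mu> \<xi> = (\<integral>z. cis (2 * pi * Re (z * cnj \<xi>)) \<partial>\<mu>)"

definition D2_sigma :: "real \<Rightarrow> complex measure set" where
  "D2_sigma \<sigma> = {\<mu>. \<exists>C. \<forall>\<xi>. 1 \<le> cmod \<xi> \<longrightarrow> cmod (fourier_transform \<mu> \<xi>) \<le> C * cmod \<xi> powr (- \<sigma>)}"

definition D2 :: "complex measure set" where
  "D2 = (\<Union>\<sigma>\<in>{0<..}. D2_sigma \<sigma>)"

end

theory Submission
  imports Defs
begin

text \<open>
  The proof is a planar Erdos--Kahane argument. Put \<open>s = log \<lambda>\<close>. The Fourier transform of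
  \<open>\<eta>\<close> at \<open>\<xi>\<close> is a product of factors whose modulus stays away from \<open>1\<close> whenever the letter is
  \<open>i0\<close> and \<open>Re (\<zeta> * exp (s * S n))\<close> is not close to an integer, where \<open>\<zeta>\<close> is a fixed multiple of
  the conjugate of \<open>\<xi>\<close> and \<open>S n\<close> is the sum of the first \<open>n\<close> exponents. If \<open>z = exp (\<beta> i0 * s)\<close>
  is not real, four consecutive values \<open>Re (u * z ^ j)\<close> determine \<open>z\<close> (hence \<open>s\<close>) and \<open>u\<close>
  stably, by the second order recurrence they satisfy. Cut the time axis into long blocks; almost
  surely, all but a small proportion of them contain four consecutive letters \<open>i0\<close>. Running from
  small to large frequencies, the nearest integers observed in a block determine those of the next
  block uniquely if both blocks are close to integers, and up to boundedly many choices otherwise.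
  So the parameters for which most blocks are close to integers are covered by few sets of
  exponentially small diameter. What remains are the curves on which some \<open>\<lambda> powr \<beta> i\<close> is real,
  and these have dimension one.
\<close>

section \<open>Hausdorff content\<close>

lemma diameter_le_dist:
  fixes S :: "'a::metric_space set"
  assumes "0 \<le> d" "\<And>x y. x \<in> S \<Longrightarrow> y \<in> S \<Longrightarrow> dist x y \<le> d"
  shows "diameter S \<le> d"
  unfolding diameter_def using assms by (auto intro!: cSUP_least)

text \<open>No bound on the diameters is imposed: for \<open>s > 0\<close> a small cost forces small diameters.\<close>

definition hausdorff_content :: "real \<Rightarrow> 'a::metric_space set \<Rightarrow> ennreal" where
  "hausdorff_content s A =
     (INF C \<in> {C :: nat \<Rightarrow> 'a set. A \<subseteq> (\<Union>n. C n) \<and> (\<forall>n. bounded (C n))}.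
        (\<Sum>n. ennreal (diameter (C n) powr s)))"

lemma hausdorff_content_le_suminf:
  assumes "A \<subseteq> (\<Union>n. C n)" "\<And>n. bounded (C n)"
  shows "hausdorff_content s A \<le> (\<Sum>n. ennreal (diameter (C n) powr s))"
  unfolding hausdorff_content_def using assms by (intro INF_lower) auto

lemma hausdorff_content_less_cover:
  assumes "hausdorff_content s A < x"
  obtains C :: "nat \<Rightarrow> 'a::metric_space set" where
    "A \<subseteq> (\<Union>n. C n)" "\<And>n. bounded (C n)" "(\<Sum>n. ennreal (diameter (C n) powr s)) < x"
  using assms unfolding hausdorff_content_def INF_less_iff by auto

lemma hausdorff_content_mono: "A \<subseteq> B \<Longrightarrow> hausdorff_content s A \<le> hausdorff_content s B"
  unfolding hausdorff_content_def by (intro INF_superset_mono) auto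

lemma hausdorff_content_eq_0_subset:
  "hausdorff_content s B = 0 \<Longrightarrow> A \<subseteq> B \<Longrightarrow> hausdorff_content s A = 0"
  using hausdorff_content_mono[of A B s] by simp

lemma hausdorff_content_empty [simp]: "hausdorff_content s {} = 0"
  using hausdorff_content_le_suminf[of "{}" "\<lambda>_. {}" s] by simp

lemma hausdorff_content_UN_le_suminf:
  fixes A :: "nat \<Rightarrow> 'a::metric_space set"
  shows "hausdorff_content s (\<Union>n. A n) \<le> (\<Sum>n. hausdorff_content s (A n))"
proof (rule ennreal_le_epsilon)
  fix e :: real
  assume finite: "(\<Sum>n. hausdorff_content s (A n)) < top" and e_pos: "0 < e"
  let ?excess = "\<lambda>n. e * (1/2) ^ Suc n"
  have "\<exists>C. A n \<subseteq> (\<Union>k. C k) \<and> (\<forall>k. bounded (C k)) \<and>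
      (\<Sum>k. ennreal (diameter (C k) powr s)) \<le> hausdorff_content s (A n) + ennreal (?excess n)" for n
  proof -
    have "hausdorff_content s (A n) < top"
      by (rule ennreal_suminf_lessD[OF finite])
    then have "hausdorff_content s (A n) < hausdorff_content s (A n) + ennreal (?excess n)"
      using e_pos by (simp add: ennreal_add_left_cancel_less)
    then show ?thesis by (rule hausdorff_content_less_cover) (blast intro: less_imp_le)
  qed
  then obtain C where cover: "\<And>n. A n \<subseteq> (\<Union>k. C n k)" and bounded: "\<And>n k. bounded (C n k)"
    and cost: "\<And>n. (\<Sum>k. ennreal (diameter (C n k) powr s))
        \<le> hausdorff_content s (A n) + ennreal (?excess n)"
    by metis
  have "(\<Union>n. A n) \<subseteq> (\<Union>i. case_prod C (prod_decode i))"
  proof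
    fix x assume "x \<in> (\<Union>n. A n)"
    then obtain n k where "x \<in> C n k" using cover by blast
    then have "x \<in> case_prod C (prod_decode (prod_encode (n, k)))" by simp
    then show "x \<in> (\<Union>i. case_prod C (prod_decode i))" by (rule UN_I[OF UNIV_I])
  qed
  then have "hausdorff_content s (\<Union>n. A n)
      \<le> (\<Sum>i. ennreal (diameter (case_prod C (prod_decode i)) powr s))"
    using bounded by (intro hausdorff_content_le_suminf) (auto split: prod.split)
  also have "\<dots> = (\<Sum>n. \<Sum>k. ennreal (diameter (C n k) powr s))"
    unfolding prod.case_distrib[where h = "\<lambda>S. ennreal (diameter S powr s)"]
    by (rule suminf_ennreal_2dimen) simp
  also have "\<dots> \<le> (\<Sum>n. hausdorff_content s (A n) + ennreal (?excess n))"
    by (intro suminf_le cost) auto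
  also have "\<dots> = (\<Sum>n. hausdorff_content s (A n)) + (\<Sum>n. ennreal (?excess n))"
    by (rule suminf_add[symmetric]) auto
  also have "(\<Sum>n. ennreal (?excess n)) = ennreal e"
    using sums_mult[OF power_half_series, of e] e_pos
    by (subst suminf_ennreal2) (auto simp: sums_iff)
  finally show "hausdorff_content s (\<Union>n. A n) \<le> (\<Sum>n. hausdorff_content s (A n)) + ennreal e" .
qed

lemma hausdorff_content_UN_eq_0:
  assumes "countable I" and "\<And>i. i \<in> I \<Longrightarrow> hausdorff_content s (A i) = 0"
  shows "hausdorff_content s (\<Union>i\<in>I. A i) = 0"
proof (cases "I = {}")
  case False
  then have "(\<Union>i\<in>I. A i) = (\<Union>n. A (from_nat_into I n))"
    using range_from_nat_into[OF False assms(1)] by (metis image_image)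
  then show ?thesis
    using hausdorff_content_UN_le_suminf[of s "\<lambda>n. A (from_nat_into I n)"] assms(2)
      from_nat_into[OF False]
    by simp
qed simp

lemma hausdorff_content_Un_eq_0:
  assumes "hausdorff_content s A = 0" "hausdorff_content s B = 0"
  shows "hausdorff_content s (A \<union> B) = 0"
  using hausdorff_content_UN_eq_0[of "{A, B}" s "\<lambda>S. S"] assms by auto

lemma hausdorff_content_limsup_eq_0:
  fixes E :: "nat \<Rightarrow> 'a::metric_space set"
  assumes "summable a" "\<And>n. 0 \<le> a n"
    and "\<forall>\<^sub>F n in sequentially. hausdorff_content s (E n) \<le> ennreal (a n)"
  shows "hausdorff_content s (limsup E) = 0"
proof -
  obtain n0 where content_le: "\<And>n. n0 \<le> n \<Longrightarrow> hausdorff_content s (E n) \<le> ennreal (a n)"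
    using assms(3) unfolding eventually_sequentially by blast
  have "hausdorff_content s (limsup E) \<le> 0"
  proof (rule ennreal_le_epsilon)
    fix e :: real assume e_pos: "0 < e"
    obtain n1 where "\<forall>n\<ge>n1. norm (\<Sum>k. a (k + n)) < e"
      using suminf_exist_split[OF e_pos assms(1)] by blast
    then have "norm (\<Sum>k. a (k + max n0 n1)) < e" by simp
    then obtain n where tail: "n0 \<le> n" "(\<Sum>k. a (k + n)) \<le> e"
      by (intro that[of "max n0 n1"]) auto
    have "limsup E \<subseteq> (\<Union>k. E (k + n))"
    proof
      fix x assume "x \<in> limsup E"
      then obtain N where "n \<le> N" "x \<in> E N" unfolding limsup_INF_SUP by auto
      then have "x \<in> E ((N - n) + n)" by simp
      then show "x \<in> (\<Union>k. E (k + n))" by (rule UN_I[OF UNIV_I])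
    qed
    then have "hausdorff_content s (limsup E) \<le> (\<Sum>k. hausdorff_content s (E (k + n)))"
      by (rule order_trans[OF hausdorff_content_mono hausdorff_content_UN_le_suminf])
    also have "\<dots> \<le> (\<Sum>k. ennreal (a (k + n)))"
      using tail(1) by (intro suminf_le content_le) auto
    also have "\<dots> = ennreal (\<Sum>k. a (k + n))"
      using assms(1,2) by (intro suminf_ennreal2) (auto simp: summable_iff_shift)
    also have "\<dots> \<le> ennreal e" using tail(2) by (rule ennreal_leI)
    finally show "hausdorff_content s (limsup E) \<le> 0 + ennreal e" by simp
  qed
  then show ?thesis by simp
qed

lemma hausdorff_content_closure_image_le:
  fixes g :: "'p \<Rightarrow> 'a::metric_space"
  assumes finite: "finite (label ` P)" and r_nonneg: "0 \<le> r" and s_nonneg: "0 \<le> s"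
    and close: "\<And>p p'. p \<in> P \<Longrightarrow> p' \<in> P \<Longrightarrow> label p = label p' \<Longrightarrow> dist (g p) (g p') \<le> r"
  shows "hausdorff_content s (closure (g ` P)) \<le> ennreal (card (label ` P) * r powr s)"
proof -
  let ?n = "card (label ` P)"
  obtain l where enumeration: "bij_betw l {..<?n} (label ` P)"
    using ex_bij_betw_nat_finite[OF finite] by (auto simp: lessThan_atLeast0)
  define C where "C k = (if k < ?n then closure (g ` {p\<in>P. label p = l k}) else {})" for k
  have dist_le: "dist x y \<le> r"
    if "x \<in> g ` {p\<in>P. label p = l k}" "y \<in> g ` {p\<in>P. label p = l k}" for k x y
    using that close by auto
  then have bounded: "bounded (g ` {p\<in>P. label p = l k})" for k
    unfolding bounded_two_points by blast
  have diameter: "diameter (C k) \<le> r" for k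
    using diameter_le_dist[OF r_nonneg dist_le] r_nonneg
    by (simp add: C_def diameter_closure[OF bounded])
  have bounded_C: "bounded (C k)" for k using bounded[of k] by (simp add: C_def bounded_closure)
  have "g ` P \<subseteq> (\<Union>k<?n. C k)"
  proof
    fix x assume "x \<in> g ` P"
    then obtain p where p_in: "p \<in> P" "x = g p" by blast
    then obtain k where "k < ?n" "l k = label p"
      using bij_betw_imp_surj_on[OF enumeration] by (metis imageE imageI lessThan_iff)
    then show "x \<in> (\<Union>k<?n. C k)"
      using p_in closure_subset[of "g ` {p\<in>P. label p = l k}"] by (force simp: C_def)
  qed
  moreover have "closed (\<Union>k<?n. C k)" by (intro closed_UN) (auto simp: C_def)
  ultimately have "closure (g ` P) \<subseteq> (\<Union>k<?n. C k)" by (rule closure_minimal)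
  then have "hausdorff_content s (closure (g ` P)) \<le> (\<Sum>k. ennreal (diameter (C k) powr s))"
    using bounded_C by (intro hausdorff_content_le_suminf) blast+
  also have "\<dots> = (\<Sum>k<?n. ennreal (diameter (C k) powr s))"
    by (intro suminf_finite) (auto simp: C_def)
  also have "\<dots> \<le> (\<Sum>k<?n. ennreal (r powr s))"
    using diameter diameter_ge_0[OF bounded_C] s_nonneg
    by (intro sum_mono ennreal_leI powr_mono2) auto
  also have "\<dots> = ennreal (?n * r powr s)"
    by (simp add: ennreal_mult ennreal_of_nat_eq_real_of_nat)
  finally show ?thesis .
qed

lemma
  assumes lipschitz: "L-lipschitz_on S f" and bounded: "bounded S"
  shows bounded_lipschitz_image: "bounded (f ` S)"
    and diameter_lipschitz_image_le: "diameter (f ` S) \<le> L * diameter S"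
proof -
  have dist_le: "dist x y \<le> L * diameter S" if image: "x \<in> f ` S" "y \<in> f ` S" for x y
  proof -
    obtain a b where preimage: "a \<in> S" "b \<in> S" "x = f a" "y = f b" using image by blast
    then have "dist x y \<le> L * dist a b" using lipschitz_onD[OF lipschitz] by blast
    also have "\<dots> \<le> L * diameter S"
      using diameter_bounded_bound[OF bounded] preimage lipschitz_on_nonneg[OF lipschitz]
      by (intro mult_left_mono) auto
    finally show ?thesis .
  qed
  then show "bounded (f ` S)" unfolding bounded_two_points by blast
  show "diameter (f ` S) \<le> L * diameter S"
    using dist_le lipschitz_on_nonneg[OF lipschitz] diameter_ge_0[OF bounded]
    by (intro diameter_le_dist) auto
qed

lemma hausdorff_content_lipschitz_image_eq_0:
  assumes null: "hausdorff_content s A = 0" and s_pos: "0 < s" and lipschitz: "L-lipschitz_on A f"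
  shows "hausdorff_content s (f ` A) = 0"
proof -
  have L_nonneg: "0 \<le> L" using lipschitz by (rule lipschitz_on_nonneg)
  have "hausdorff_content s (f ` A) \<le> 0"
  proof (rule ennreal_le_epsilon)
    fix e :: real assume e_pos: "0 < e"
    have "hausdorff_content s A < ennreal (e / (L powr s + 1))"
      using null e_pos by (simp add: add_nonneg_pos)
    then obtain C where cover: "A \<subseteq> (\<Union>n. C n)" and bounded: "\<And>n. bounded (C n)"
      and cost: "(\<Sum>n. ennreal (diameter (C n) powr s)) < ennreal (e / (L powr s + 1))"
      by (rule hausdorff_content_less_cover) blast
    let ?D = "\<lambda>n. f ` (C n \<inter> A)"
    have lipschitz_piece: "L-lipschitz_on (C n \<inter> A) f" and bounded_piece: "bounded (C n \<inter> A)" for n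
      using lipschitz bounded by (auto intro: lipschitz_on_subset bounded_Int)
    have "f ` A \<subseteq> (\<Union>n. ?D n)" using cover by blast
    then have "hausdorff_content s (f ` A) \<le> (\<Sum>n. ennreal (diameter (?D n) powr s))"
      using bounded_lipschitz_image[OF lipschitz_piece bounded_piece]
      by (rule hausdorff_content_le_suminf)
    also have "\<dots> \<le> (\<Sum>n. ennreal (L powr s) * ennreal (diameter (C n) powr s))"
    proof (intro suminf_le allI)
      fix n
      have "diameter (?D n) \<le> L * diameter (C n \<inter> A)"
        by (rule diameter_lipschitz_image_le[OF lipschitz_piece bounded_piece])
      also have "\<dots> \<le> L * diameter (C n)"
        using L_nonneg bounded by (intro mult_left_mono diameter_subset) auto
      finally have "diameter (?D n) powr s \<le> (L * diameter (C n)) powr s"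
        using s_pos diameter_ge_0[OF bounded_lipschitz_image[OF lipschitz_piece bounded_piece]]
        by (intro powr_mono2) auto
      then show "ennreal (diameter (?D n) powr s)
          \<le> ennreal (L powr s) * ennreal (diameter (C n) powr s)"
        using L_nonneg diameter_ge_0[OF bounded] by (simp add: powr_mult flip: ennreal_mult)
    qed auto
    also have "\<dots> \<le> ennreal (L powr s) * ennreal (e / (L powr s + 1))"
      using cost by (simp add: mult_left_mono less_imp_le)
    also have "\<dots> \<le> ennreal e"
      using e_pos
      by (simp add: pos_divide_le_eq add_nonneg_pos distrib_left mult.commute flip: ennreal_mult)
    finally show "hausdorff_content s (f ` A) \<le> 0 + ennreal e" by simp
  qed
  then show ?thesis by simp
qed

lemma hausdorff_content_unit_interval_le:
  assumes n_ge_1: "1 \<le> n" and s_nonneg: "0 \<le> s"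
  shows "hausdorff_content s {a..a+1::real} \<le> ennreal (2 * real n powr (1 - s))"
proof -
  let ?label = "\<lambda>x. \<lfloor>(x - a) * n\<rfloor>"
  have "\<lfloor>x * n\<rfloor> \<in> {0..int n}" if "x \<in> {0..1}" for x :: real
    using that mult_left_le_one_le[of "real n" x] by (auto simp: floor_le_iff)
  then have labels: "?label ` {a..a+1} \<subseteq> {0..int n}" by auto
  then have "card (?label ` {a..a+1}) \<le> card {0..int n}" by (intro card_mono) auto
  then have count: "real (card (?label ` {a..a+1})) \<le> 2 * real n" using n_ge_1 by simp
  have "dist x y \<le> 1 / n" if "?label x = ?label y" for x y
  proof -
    have "\<bar>(x - a) * n - (y - a) * n\<bar> \<le> 1" using that by linarith
    moreover have "(x - a) * n - (y - a) * n = (x - y) * n" by (simp add: algebra_simps)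
    ultimately show ?thesis using n_ge_1 by (simp add: dist_real_def abs_mult pos_le_divide_eq)
  qed
  then have "hausdorff_content s (closure ((\<lambda>x. x) ` {a..a+1}))
      \<le> ennreal (card (?label ` {a..a+1}) * (1 / n) powr s)"
    using s_nonneg finite_subset[OF labels] by (intro hausdorff_content_closure_image_le) auto
  also have "\<dots> \<le> ennreal (2 * real n * (1 / n) powr s)"
    using count by (intro ennreal_leI mult_right_mono) auto
  also have "2 * real n * (1 / n) powr s = 2 * real n powr (1 - s)"
    using n_ge_1 by (simp add: powr_diff powr_divide)
  finally show ?thesis by simp
qed

lemma hausdorff_content_real_UNIV:
  assumes s_gt_1: "1 < s"
  shows "hausdorff_content s (UNIV :: real set) = 0"
proof -
  have "((\<lambda>x::real. x powr (1 - s)) \<longlongrightarrow> 0) at_top"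
    using s_gt_1 tendsto_neg_powr[of "1 - s" "\<lambda>x. x" at_top] by (simp add: filterlim_ident)
  then have "(\<lambda>n. 2 * real n powr (1 - s)) \<longlonglongrightarrow> 2 * 0"
    by (intro tendsto_mult tendsto_const filterlim_compose[OF _ filterlim_real_sequentially])
  then have bound_tendsto_0: "(\<lambda>n. ennreal (2 * real n powr (1 - s))) \<longlonglongrightarrow> ennreal 0"
    by (intro tendsto_ennrealI) simp
  have "hausdorff_content s {a..a+1::real} \<le> ennreal 0" for a
    using s_gt_1 by (intro LIMSEQ_le_const[OF bound_tendsto_0])
      (auto intro!: exI[of _ 1] hausdorff_content_unit_interval_le)
  then have "hausdorff_content s (\<Union>j::int. {of_int j..of_int j + 1::real}) = 0"
    by (intro hausdorff_content_UN_eq_0) auto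
  moreover have "x \<in> (\<Union>j::int. {of_int j..of_int j + 1::real})" for x :: real
    by (intro UN_I[of "\<lfloor>x\<rfloor>"]) (auto simp: less_imp_le)
  ultimately show ?thesis by (auto elim: hausdorff_content_eq_0_subset)
qed

lemma hausdorff_measure_eq_0:
  assumes s_pos: "0 < s" and null: "hausdorff_content s A = 0"
  shows "hausdorff_measure s A = 0"
proof -
  have "hausdorff_pre s \<delta> A \<le> 0" if \<delta>_pos: "0 < \<delta>" for \<delta>
  proof (rule ennreal_le_epsilon)
    fix e :: real assume e_pos: "0 < e"
    define e' where "e' = min e (\<delta> powr s)"
    have "hausdorff_content s A < ennreal e'" using null e_pos \<delta>_pos by (simp add: e'_def)
    then obtain C where cover: "A \<subseteq> (\<Union>n. C n)" and bounded: "\<And>n. bounded (C n)"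
      and cost: "(\<Sum>n. ennreal (diameter (C n) powr s)) < ennreal e'"
      by (rule hausdorff_content_less_cover) blast
    have "diameter (C n) \<le> \<delta>" for n
    proof (rule ccontr)
      assume "\<not> diameter (C n) \<le> \<delta>"
      then have "\<delta> powr s \<le> diameter (C n) powr s" using s_pos \<delta>_pos by (intro powr_mono2) auto
      moreover have "ennreal (diameter (C n) powr s) < ennreal e'"
        by (rule ennreal_suminf_lessD[OF cost])
      ultimately show False by (simp add: ennreal_less_iff e'_def)
    qed
    then have "hausdorff_pre s \<delta> A \<le> (\<Sum>n. ennreal (diameter (C n) powr s))"
      unfolding hausdorff_pre_def using cover bounded by (intro INF_lower) auto
    also have "\<dots> \<le> ennreal e'" using cost by (rule less_imp_le)
    also have "\<dots> \<le> ennreal e" by (rule ennreal_leI) (simp add: e'_def)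
    finally show "hausdorff_pre s \<delta> A \<le> 0 + ennreal e" by simp
  qed
  then show ?thesis unfolding hausdorff_measure_def by (auto simp: SUP_eq_iff)
qed

lemma hausdorff_dim_le:
  assumes "0 \<le> d" and "\<And>s. d < s \<Longrightarrow> hausdorff_content s A = 0"
  shows "hausdorff_dim A \<le> ereal d"
proof (rule ereal_le_epsilon2)
  fix e :: real assume "0 < e"
  then have "hausdorff_measure (d + e) A = 0"
    using assms by (intro hausdorff_measure_eq_0) auto
  then have "hausdorff_dim A \<le> ereal (d + e)"
    unfolding hausdorff_dim_def using \<open>0 < e\<close> assms(1) by (intro INF_lower) auto
  then show "hausdorff_dim A \<le> ereal d + ereal e" by simp
qed

section \<open>Recovering a multiplier from four observations\<close>

lemma Re_mult_power_recurrence: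
  "Re (w * z ^ (j + 2)) = 2 * Re z * Re (w * z ^ (j + 1)) - (cmod z)^2 * Re (w * z ^ j)"
proof -
  have "Re (v * z^2) = 2 * Re z * Re (v * z) - (cmod z)^2 * Re v" for v
    unfolding cmod_power2 by (simp add: power2_eq_square algebra_simps)
  from this[of "w * z ^ j"] show ?thesis by (simp only: power_add power_one_right mult.assoc)
qed

lemma Re_mult_power_det:
  "(Re (w * z))^2 - Re w * Re (w * z^2) = (cmod w)^2 * (Im z)^2"
  unfolding cmod_power2 by (simp add: power2_eq_square algebra_simps)

lemma recurrence_coefficients_stable:
  fixes x y :: "nat \<Rightarrow> real"
  assumes x_rec: "\<And>j. x (j + 2) = a * x (j + 1) - b * x j"
    and y_rec: "\<And>j. y (j + 2) = a' * y (j + 1) - b' * y j"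
    and a_bound: "\<bar>a\<bar> \<le> 2" and b_bound: "\<bar>b\<bar> \<le> 1"
    and near: "\<And>j. j < 4 \<Longrightarrow> \<bar>x j - y j\<bar> \<le> e"
    and y_le: "\<And>j. \<bar>y j\<bar> \<le> U"
  shows "\<bar>a - a'\<bar> * \<bar>(y 1)^2 - y 0 * y 2\<bar> \<le> 8 * e * U"
    and "\<bar>b - b'\<bar> * \<bar>(y 1)^2 - y 0 * y 2\<bar> \<le> 8 * e * U"
proof -
  define r where "r j = (a - a') * y (j + 1) - (b - b') * y j" for j
  have r_le: "\<bar>r j\<bar> \<le> 4 * e" if "j < 2" for j
  proof -
    have "r j = (x (j + 2) - y (j + 2)) - a * (x (j + 1) - y (j + 1)) + b * (x j - y j)"
      unfolding r_def x_rec y_rec by (simp add: algebra_simps)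
    moreover have "\<bar>a * (x (j + 1) - y (j + 1))\<bar> \<le> 2 * e"
      unfolding abs_mult using a_bound near[of "j + 1"] that by (intro mult_mono) auto
    moreover have "\<bar>b * (x j - y j)\<bar> \<le> 1 * e"
      unfolding abs_mult using b_bound near[of j] that by (intro mult_mono) auto
    moreover have "\<bar>x (j + 2) - y (j + 2)\<bar> \<le> e" using near that by simp
    ultimately show ?thesis by linarith
  qed
  \<comment> \<open>Cramer's rule for the linear system of \<open>r 0\<close> and \<open>r 1\<close> in \<open>a - a'\<close> and \<open>b - b'\<close>\<close>
  have cramer: "\<bar>y i * r 0 - y j * r 1\<bar> \<le> 8 * e * U" for i j
  proof -
    have "\<bar>y i * r 0 - y j * r 1\<bar> \<le> \<bar>y i\<bar> * \<bar>r 0\<bar> + \<bar>y j\<bar> * \<bar>r 1\<bar>"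
      by (metis abs_mult abs_triangle_ineq4)
    also have "\<dots> \<le> U * (4 * e) + U * (4 * e)"
      using r_le y_le order_trans[OF abs_ge_zero y_le] by (intro add_mono mult_mono) auto
    finally show ?thesis by (simp add: mult.commute)
  qed
  have r_0_1: "r 0 = (a - a') * y 1 - (b - b') * y 0" "r 1 = (a - a') * y 2 - (b - b') * y 1"
    by (simp_all add: r_def numeral_2_eq_2)
  have "(a - a') * ((y 1)^2 - y 0 * y 2) = y 1 * r 0 - y 0 * r 1"
    unfolding r_0_1 by (simp add: algebra_simps power2_eq_square)
  then show "\<bar>a - a'\<bar> * \<bar>(y 1)^2 - y 0 * y 2\<bar> \<le> 8 * e * U"
    using cramer[of 1 0] by (simp flip: abs_mult)
  have "(b - b') * ((y 1)^2 - y 0 * y 2) = y 2 * r 0 - y 1 * r 1"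
    unfolding r_0_1 by (simp add: algebra_simps power2_eq_square)
  then show "\<bar>b - b'\<bar> * \<bar>(y 1)^2 - y 0 * y 2\<bar> \<le> 8 * e * U"
    using cramer[of 2 1] by (simp flip: abs_mult)
qed

lemma abs_Im_diff_le:
  assumes "cmod z \<le> 1" "cmod z' \<le> 1" "\<delta> \<le> \<bar>Im z\<bar>" "\<delta> \<le> \<bar>Im z'\<bar>" "0 < Im z * Im z'"
  shows "2 * \<delta> * \<bar>Im z - Im z'\<bar> \<le> \<bar>(cmod z)^2 - (cmod z')^2\<bar> + 2 * \<bar>Re z - Re z'\<bar>"
proof -
  have "2 * \<delta> \<le> \<bar>Im z + Im z'\<bar>" using assms(3-5) by (auto simp: zero_less_mult_iff)
  then have "2 * \<delta> * \<bar>Im z - Im z'\<bar> \<le> \<bar>Im z + Im z'\<bar> * \<bar>Im z - Im z'\<bar>"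
    by (intro mult_right_mono) auto
  also have "\<dots> = \<bar>((cmod z)^2 - (cmod z')^2) - (Re z + Re z') * (Re z - Re z')\<bar>"
    unfolding abs_mult[symmetric] cmod_power2 by (simp add: power2_eq_square algebra_simps)
  also have "\<dots> \<le> \<bar>(cmod z)^2 - (cmod z')^2\<bar> + \<bar>Re z + Re z'\<bar> * \<bar>Re z - Re z'\<bar>"
    by (metis abs_mult abs_triangle_ineq4)
  also have "\<dots> \<le> \<bar>(cmod z)^2 - (cmod z')^2\<bar> + 2 * \<bar>Re z - Re z'\<bar>"
  proof -
    have "\<bar>Re z + Re z'\<bar> \<le> 2"
      using abs_Re_le_cmod[of z] abs_Re_le_cmod[of z'] assms(1,2) by linarith
    then show ?thesis by (intro add_left_mono mult_right_mono) auto
  qed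
  finally show ?thesis .
qed

context
  fixes z z' u u' :: complex and \<delta> e :: real
  assumes in_disc: "cmod z \<le> 1" "cmod z' \<le> 1"
    and Im_bounds: "0 < \<delta>" "\<delta> \<le> \<bar>Im z\<bar>" "\<delta> \<le> \<bar>Im z'\<bar>"
    and same_side: "0 < Im z * Im z'"
    and near: "\<And>j. j < 4 \<Longrightarrow> \<bar>Re (u * z ^ j) - Re (u' * z' ^ j)\<bar> \<le> e"
begin

lemma trace_and_norm_stable:
  "\<bar>Re z - Re z'\<bar> * cmod u' \<le> 4 * e / \<delta>^2"
  "\<bar>(cmod z)^2 - (cmod z')^2\<bar> * cmod u' \<le> 8 * e / \<delta>^2"
proof -
  have e_nonneg: "0 \<le> e" using near[of 0] by simp
  let ?y = "\<lambda>j. Re (u' * z' ^ j)"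
  have "\<bar>?y j\<bar> \<le> cmod u'" for j
  proof -
    have "\<bar>?y j\<bar> \<le> cmod u' * cmod z' ^ j"
      using abs_Re_le_cmod[of "u' * z' ^ j"] by (simp only: norm_mult norm_power)
    also have "\<dots> \<le> cmod u' * 1" using in_disc(2) by (intro mult_left_mono power_le_one) auto
    finally show ?thesis by simp
  qed
  moreover have "\<bar>2 * Re z\<bar> \<le> 2" "\<bar>(cmod z)^2\<bar> \<le> 1"
    using abs_Re_le_cmod[of z] in_disc(1) by (simp_all add: power_le_one abs_mult)
  ultimately have system:
    "\<bar>2 * Re z - 2 * Re z'\<bar> * \<bar>(?y 1)^2 - ?y 0 * ?y 2\<bar> \<le> 8 * e * cmod u'"
    "\<bar>(cmod z)^2 - (cmod z')^2\<bar> * \<bar>(?y 1)^2 - ?y 0 * ?y 2\<bar> \<le> 8 * e * cmod u'"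
    using recurrence_coefficients_stable[of "\<lambda>j. Re (u * z ^ j)" "2 * Re z" "(cmod z)^2" ?y
        "2 * Re z'" "(cmod z')^2" e "cmod u'"] Re_mult_power_recurrence near by blast+
  have det: "\<delta>^2 * (cmod u')^2 \<le> \<bar>(?y 1)^2 - ?y 0 * ?y 2\<bar>"
  proof -
    have "\<delta>^2 \<le> (Im z')^2" using Im_bounds by (metis abs_ge_zero less_imp_le power2_abs power_mono)
    then have "\<delta>^2 * (cmod u')^2 \<le> (cmod u')^2 * (Im z')^2"
      by (simp add: mult.commute[of "\<delta>^2"] mult_left_mono)
    also have "\<dots> = (?y 1)^2 - ?y 0 * ?y 2" using Re_mult_power_det[of u' z'] by simp
    finally show ?thesis by simp
  qed
  have divide_det: "\<bar>q\<bar> * cmod u' \<le> 8 * e / \<delta>^2"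
    if "\<bar>q\<bar> * \<bar>(?y 1)^2 - ?y 0 * ?y 2\<bar> \<le> 8 * e * cmod u'" for q
  proof (cases "u' = 0")
    case False
    have "\<bar>q\<bar> * (\<delta>^2 * (cmod u')^2) \<le> 8 * e * cmod u'"
      using mult_left_mono[OF det, of "\<bar>q\<bar>"] that by linarith
    then have "\<bar>q\<bar> * cmod u' * \<delta>^2 * cmod u' \<le> 8 * e * cmod u'"
      by (simp add: power2_eq_square mult_ac)
    then show ?thesis using False Im_bounds(1) by (simp add: pos_le_divide_eq mult_ac)
  qed (use e_nonneg in simp)
  show "\<bar>Re z - Re z'\<bar> * cmod u' \<le> 4 * e / \<delta>^2"
    using divide_det[OF system(1)] unfolding right_diff_distrib[symmetric] abs_mult by simp
  show "\<bar>(cmod z)^2 - (cmod z')^2\<bar> * cmod u' \<le> 8 * e / \<delta>^2"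
    using divide_det[OF system(2)] .
qed

lemma multiplier_stable: "cmod (z - z') * cmod u' \<le> 12 * e / \<delta>^3"
proof -
  have e_nonneg: "0 \<le> e" using near[of 0] by simp
  have "\<delta> \<le> 1" using Im_bounds(2) abs_Im_le_cmod[of z] in_disc(1) by linarith
  then have power: "e / \<delta>^2 \<le> e / \<delta>^3"
    using Im_bounds(1) e_nonneg by (intro divide_left_mono power_decreasing) auto
  have "2 * \<delta> * \<bar>Im z - Im z'\<bar> * cmod u'
      \<le> (\<bar>(cmod z)^2 - (cmod z')^2\<bar> + 2 * \<bar>Re z - Re z'\<bar>) * cmod u'"
    using abs_Im_diff_le[OF in_disc Im_bounds(2,3) same_side] by (rule mult_right_mono) simp
  also have "\<dots> \<le> 16 * e / \<delta>^2"
    using trace_and_norm_stable unfolding distrib_right mult.assoc by simp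
  finally have Im_diff: "\<bar>Im z - Im z'\<bar> * cmod u' \<le> 8 * e / \<delta>^3"
    using Im_bounds(1) by (simp add: field_simps power2_eq_square power3_eq_cube)
  have "cmod (z - z') * cmod u' \<le> (\<bar>Re z - Re z'\<bar> + \<bar>Im z - Im z'\<bar>) * cmod u'"
    using cmod_le[of "z - z'"] by (intro mult_right_mono) auto
  also have "\<dots> \<le> 12 * e / \<delta>^3"
    using trace_and_norm_stable(1) Im_diff power by (simp add: distrib_right)
  finally show ?thesis .
qed

lemma amplitude_stable: "cmod (u - u') \<le> 15 * e / \<delta>^4"
proof -
  have e_nonneg: "0 \<le> e" using near[of 0] by simp
  have \<delta>_le_1: "\<delta> \<le> 1" using Im_bounds(2) abs_Im_le_cmod[of z] in_disc(1) by linarith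
  have Re_diff: "\<bar>Re (u - u')\<bar> \<le> e" using near[of 0] by simp
  have "Im (u - u') * Im z = Re (u - u') * Re z - (Re (u * z) - Re (u' * z')) + Re (u' * (z - z'))"
    by (simp add: algebra_simps)
  then have "\<bar>Im (u - u')\<bar> * \<bar>Im z\<bar>
      \<le> \<bar>Re (u - u')\<bar> * \<bar>Re z\<bar> + \<bar>Re (u * z) - Re (u' * z')\<bar> + \<bar>Re (u' * (z - z'))\<bar>"
    unfolding abs_mult[symmetric] by linarith
  also have "\<dots> \<le> e * 1 + e + 12 * e / \<delta>^3"
  proof (intro add_mono mult_mono)
    show "\<bar>Re z\<bar> \<le> 1" using abs_Re_le_cmod[of z] in_disc(1) by linarith
    show "\<bar>Re (u * z) - Re (u' * z')\<bar> \<le> e" using near[of 1] by simp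
    show "\<bar>Re (u' * (z - z'))\<bar> \<le> 12 * e / \<delta>^3"
      using abs_Re_le_cmod[of "u' * (z - z')"] multiplier_stable
      by (simp add: norm_mult mult.commute)
  qed (use Re_diff e_nonneg in auto)
  also have "\<dots> \<le> 14 * e / \<delta>^3"
    using Im_bounds(1) \<delta>_le_1 e_nonneg divide_left_mono[of "\<delta>^3" 1 e] by (simp add: power_le_one)
  finally have "\<bar>Im (u - u')\<bar> * \<bar>Im z\<bar> \<le> 14 * e / \<delta>^3" .
  moreover have "\<bar>Im (u - u')\<bar> * \<delta> \<le> \<bar>Im (u - u')\<bar> * \<bar>Im z\<bar>"
    using Im_bounds(2) by (intro mult_left_mono) auto
  ultimately have "\<bar>Im (u - u')\<bar> * \<delta> \<le> 14 * e / \<delta>^3" by linarith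
  then have "\<bar>Im (u - u')\<bar> \<le> 14 * e / \<delta>^4"
    using Im_bounds(1) by (simp add: field_simps eval_nat_numeral)
  moreover have "e \<le> e / \<delta>^4"
    using Im_bounds(1) \<delta>_le_1 e_nonneg divide_left_mono[of "\<delta>^4" 1 e] by (simp add: power_le_one)
  ultimately show ?thesis using cmod_le[of "u - u'"] Re_diff by simp
qed

end

section \<open>Counting\<close>

lemma card_image_Pair_le:
  assumes finite: "finite (f ` A)" "\<And>a. a \<in> A \<Longrightarrow> finite (g ` {a'\<in>A. f a' = f a})"
    and card_le: "\<And>a. a \<in> A \<Longrightarrow> real (card (g ` {a'\<in>A. f a' = f a})) \<le> w"
  shows "finite ((\<lambda>a. (f a, g a)) ` A)"
    and "real (card ((\<lambda>a. (f a, g a)) ` A)) \<le> real (card (f ` A)) * w"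
proof -
  have image_eq_Sigma: "(\<lambda>a. (f a, g a)) ` A = (SIGMA v : f ` A. g ` {a'\<in>A. f a' = v})"
    by (auto simp: image_iff) metis
  show "finite ((\<lambda>a. (f a, g a)) ` A)"
    unfolding image_eq_Sigma using finite by (intro finite_SigmaI) auto
  have "real (card ((\<lambda>a. (f a, g a)) ` A)) = (\<Sum>v\<in>f ` A. real (card (g ` {a'\<in>A. f a' = v})))"
    unfolding image_eq_Sigma using finite by (subst card_SigmaI) auto
  also have "\<dots> \<le> (\<Sum>v\<in>f ` A. w)" using card_le by (intro sum_mono) auto
  finally show "real (card ((\<lambda>a. (f a, g a)) ` A)) \<le> real (card (f ` A)) * w" by simp
qed

lemma card_histories_le:
  fixes K :: "nat \<Rightarrow> 'p \<Rightarrow> 'k" and w :: "nat \<Rightarrow> real"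
  assumes finite: "\<And>n p. n < N \<Longrightarrow> p \<in> F \<Longrightarrow> finite (K n ` {p'\<in>F. \<forall>i<n. K i p' = K i p})"
    and card_le: "\<And>n p. n < N \<Longrightarrow> p \<in> F \<Longrightarrow>
      real (card (K n ` {p'\<in>F. \<forall>i<n. K i p' = K i p})) \<le> w n"
    and w_nonneg: "\<And>n. 0 \<le> w n"
  shows "finite ((\<lambda>p. map (\<lambda>i. K i p) [0..<N]) ` F) \<and>
    real (card ((\<lambda>p. map (\<lambda>i. K i p) [0..<N]) ` F)) \<le> (\<Prod>n<N. w n)"
  using finite card_le
proof (induction N)
  case 0
  have subset: "(\<lambda>p. map (\<lambda>i. K i p) [0..<0]) ` F \<subseteq> {[]}" by auto
  show ?case using card_mono[OF _ subset] finite_subset[OF subset] by simp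
next
  case (Suc N)
  let ?history = "\<lambda>n p. map (\<lambda>i. K i p) [0..<n]"
  have IH: "finite (?history N ` F)" "real (card (?history N ` F)) \<le> (\<Prod>n<N. w n)"
    using Suc.IH Suc.prems by auto
  have "{p'\<in>F. ?history N p' = ?history N p} = {p'\<in>F. \<forall>i<N. K i p' = K i p}" for p
    by (auto simp: list_eq_iff_nth_eq)
  then have pairs: "finite ((\<lambda>p. (?history N p, K N p)) ` F)"
    "real (card ((\<lambda>p. (?history N p, K N p)) ` F)) \<le> real (card (?history N ` F)) * w N"
    using card_image_Pair_le[OF IH(1), of "K N" "w N"] Suc.prems by auto
  have history_Suc: "?history (Suc N) ` F = (\<lambda>(h, k). h @ [k]) ` (\<lambda>p. (?history N p, K N p)) ` F"
    by (simp add: image_image)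
  have "real (card (?history (Suc N) ` F)) \<le> real (card ((\<lambda>p. (?history N p, K N p)) ` F))"
    unfolding history_Suc using card_image_le[OF pairs(1)] by simp
  also have "\<dots> \<le> real (card (?history N ` F)) * w N" by (rule pairs(2))
  also have "\<dots> \<le> (\<Prod>n<N. w n) * w N" using IH(2) w_nonneg by (rule mult_right_mono)
  finally show ?case unfolding history_Suc using pairs(1) by simp
qed

lemma card_int_near:
  fixes y h :: real
  assumes "0 \<le> h"
  shows "finite {k::int. \<bar>of_int k - y\<bar> \<le> h}"
    and "real (card {k::int. \<bar>of_int k - y\<bar> \<le> h}) \<le> 2 * h + 1"
proof -
  have set_eq: "{k::int. \<bar>of_int k - y\<bar> \<le> h} = {\<lceil>y - h\<rceil>..\<lfloor>y + h\<rfloor>}"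
    by (auto simp: abs_le_iff ceiling_le_iff le_floor_iff)
  show "finite {k::int. \<bar>of_int k - y\<bar> \<le> h}" unfolding set_eq by simp
  have "real (card {\<lceil>y - h\<rceil>..\<lfloor>y + h\<rfloor>}) \<le> max 0 (of_int \<lfloor>y + h\<rfloor> - of_int \<lceil>y - h\<rceil> + 1)"
    by (simp add: of_nat_nat max_def)
  also have "\<dots> \<le> 2 * h + 1"
    using assms of_int_floor_le[of "y + h"] le_of_int_ceiling[of "y - h"]
    by (simp only: max.bounded_iff) linarith
  finally show "real (card {k::int. \<bar>of_int k - y\<bar> \<le> h}) \<le> 2 * h + 1" unfolding set_eq .
qed

lemma card_int_vectors_near:
  fixes y :: "'j \<Rightarrow> real"
  assumes finite_J: "finite J" and h_nonneg: "0 \<le> h"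
    and near: "S \<subseteq> (\<Pi>\<^sub>E j\<in>J. {k::int. \<bar>of_int k - y j\<bar> \<le> h})"
  shows "finite S" and "real (card S) \<le> (2 * h + 1) ^ card J"
proof -
  let ?box = "\<Pi>\<^sub>E j\<in>J. {k::int. \<bar>of_int k - y j\<bar> \<le> h}"
  have finite_box: "finite ?box"
    using finite_J card_int_near(1)[OF h_nonneg] by (intro finite_PiE) auto
  then show "finite S" using near finite_subset by blast
  have "real (card S) \<le> real (card ?box)" using card_mono[OF finite_box near] by simp
  also have "\<dots> = (\<Prod>j\<in>J. real (card {k::int. \<bar>of_int k - y j\<bar> \<le> h}))"
    by (simp add: card_PiE[OF finite_J])
  also have "\<dots> \<le> (\<Prod>j\<in>J. 2 * h + 1)" using card_int_near(2)[OF h_nonneg] by (intro prod_mono) auto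
  finally show "real (card S) \<le> (2 * h + 1) ^ card J" by simp
qed

section \<open>Distance to the integers\<close>

definition dist_Ints :: "real \<Rightarrow> real" where
  "dist_Ints x = \<bar>x - of_int (round x)\<bar>"

lemma dist_Ints_le_half: "dist_Ints x \<le> 1/2"
  using of_int_round_abs_le[of x] by (simp add: dist_Ints_def abs_minus_commute)

lemma abs_diff_le_if_round_eq: "round x = round y \<Longrightarrow> \<bar>x - y\<bar> \<le> dist_Ints x + dist_Ints y"
  by (simp add: dist_Ints_def)

lemma round_eq_if_near:
  assumes "dist_Ints x + \<bar>x - y\<bar> + dist_Ints y < 1"
  shows "round x = round y"
proof -
  have "\<bar>of_int (round x) - of_int (round y) :: real\<bar> < 1" using assms by (simp add: dist_Ints_def)
  then have "\<bar>round x - round y\<bar> < 1" by (metis of_int_abs of_int_diff of_int_less_1_iff)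
  then show ?thesis by simp
qed

lemma cos_2pi_dist_Ints: "cos (2 * pi * dist_Ints x) = cos (2 * pi * x)"
proof -
  have "cos (2 * pi * dist_Ints x) = cos \<bar>2 * pi * (x - of_int (round x))\<bar>"
    by (simp add: dist_Ints_def abs_mult)
  also have "\<dots> = cos (2 * pi * x - 2 * pi * of_int (round x))"
    by (simp add: right_diff_distrib)
  also have "\<dots> = cos (2 * pi * x)" unfolding cos_diff by simp
  finally show ?thesis .
qed

section \<open>The Fourier transform as an infinite product\<close>

lemma (in product_prob_space) integral_prod_coordinates:
  fixes f :: "'i \<Rightarrow> 'a \<Rightarrow> 'b::{real_normed_field,banach,second_countable_topology}"
  assumes J_finite: "finite J" "J \<subseteq> I" and integrable: "\<And>i. i \<in> J \<Longrightarrow> integrable (M i) (f i)"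
  shows "(\<integral>x. (\<Prod>i\<in>J. f i (x i)) \<partial>PiM I M) = (\<Prod>i\<in>J. \<integral>y. f i y \<partial>M i)"
proof -
  have "(\<integral>x. (\<Prod>i\<in>J. f i (x i)) \<partial>PiM I M) = (\<integral>x. (\<Prod>i\<in>J. f i (restrict x J i)) \<partial>PiM I M)"
    by (intro Bochner_Integration.integral_cong prod.cong) auto
  also have "\<dots> = (\<integral>x. (\<Prod>i\<in>J. f i (x i)) \<partial>distr (PiM I M) (PiM J M) (\<lambda>x. restrict x J))"
  proof (rule integral_distr[symmetric])
    show "(\<lambda>x. restrict x J) \<in> measurable (PiM I M) (PiM J M)"
      using J_finite(2) by (rule measurable_restrict_subset)
    show "(\<lambda>x. \<Prod>i\<in>J. f i (x i)) \<in> borel_measurable (PiM J M)"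
      using borel_measurable_integrable[OF integrable]
      by (intro borel_measurable_prod measurable_compose[OF measurable_component_singleton]) auto
  qed
  also have "\<dots> = (\<Prod>i\<in>J. \<integral>y. f i y \<partial>M i)"
    unfolding distr_PiM_restrict_finite[OF J_finite]
    by (rule product_integral_prod[OF J_finite(1) integrable])
  finally show ?thesis .
qed

lemma fourier_transform_distr:
  assumes "f \<in> borel_measurable M"
  shows "fourier_transform (distr M borel f) \<xi> = (\<integral>x. cis (2 * pi * Re (f x * cnj \<xi>)) \<partial>M)"
  unfolding fourier_transform_def using assms
  by (rule integral_distr) (intro borel_measurable_continuous_onI continuous_intros)

lemma prod_fourier_transform_tendsto:
  fixes M :: "nat \<Rightarrow> 'a measure" and x :: "nat \<Rightarrow> 'a \<Rightarrow> complex"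
  assumes prob: "\<And>n. prob_space (M n)" and x [measurable]: "\<And>n. x n \<in> borel_measurable (M n)"
    and summable: "AE u in PiM UNIV M. summable (\<lambda>n. x n (u n))"
  shows "(\<lambda>N. \<Prod>n<N. fourier_transform (distr (M n) borel (x n)) \<xi>)
    \<longlonglongrightarrow> fourier_transform (distr (PiM UNIV M) borel (\<lambda>u. \<Sum>n. x n (u n))) \<xi>"
proof -
  interpret product_prob_space M UNIV
    using prob by (rule product_prob_spaceI)
  define \<psi> where "\<psi> z = cis (2 * pi * Re (z * cnj \<xi>))" for z
  have \<psi>_continuous: "continuous_on UNIV \<psi>" unfolding \<psi>_def by (intro continuous_intros)
  then have [measurable]: "\<psi> \<in> borel_measurable borel" by (rule borel_measurable_continuous_onI)
  have \<psi>_bounded: "norm (\<psi> z) \<le> 1" for z by (simp add: \<psi>_def)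
  have coordinate: "(\<lambda>u. x n (u n)) \<in> borel_measurable (PiM UNIV M)" for n by measurable
  have series: "(\<lambda>u. \<Sum>n. x n (u n)) \<in> borel_measurable (PiM UNIV M)"
    by (intro borel_measurable_suminf coordinate)
  have "(\<lambda>N. \<integral>u. (\<Prod>n<N. \<psi> (x n (u n))) \<partial>PiM UNIV M) \<longlonglongrightarrow> (\<integral>u. \<psi> (\<Sum>n. x n (u n)) \<partial>PiM UNIV M)"
  proof (rule integral_dominated_convergence[where w = "\<lambda>_. 1"])
    show "(\<lambda>u. \<psi> (\<Sum>n. x n (u n))) \<in> borel_measurable (PiM UNIV M)"
      using series by measurable
    show "(\<lambda>u. \<Prod>n<N. \<psi> (x n (u n))) \<in> borel_measurable (PiM UNIV M)" for N
      using coordinate by measurable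
    show "AE u in PiM UNIV M. (\<lambda>N. \<Prod>n<N. \<psi> (x n (u n))) \<longlonglongrightarrow> \<psi> (\<Sum>n. x n (u n))"
      using summable
    proof eventually_elim
      case (elim u)
      have "(\<Prod>n<N. \<psi> (x n (u n))) = \<psi> (\<Sum>n<N. x n (u n))" for N
        by (induction N)
          (simp_all add: \<psi>_def distrib_right distrib_left cis_mult[symmetric] mult.commute)
      then show ?case
        using continuous_on_tendsto_compose[OF \<psi>_continuous summable_LIMSEQ[OF elim]] by simp
    qed
    show "AE u in PiM UNIV M. norm (\<Prod>n<N. \<psi> (x n (u n))) \<le> 1" for N
      using \<psi>_bounded by (simp add: prod_norm[symmetric] prod_le_1)
  qed simp
  also have "(\<lambda>N. \<integral>u. (\<Prod>n<N. \<psi> (x n (u n))) \<partial>PiM UNIV M) = (\<lambda>N. \<Prod>n<N. \<integral>y. \<psi> (x n y) \<partial>M n)"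
    by (intro ext integral_prod_coordinates M.integrable_const_bound[of _ 1])
      (auto simp: \<psi>_bounded)
  finally show ?thesis
    unfolding fourier_transform_distr[OF x] fourier_transform_distr[OF series] \<psi>_def .
qed

lemma sets_digit_measure [measurable_cong, simp]:
  "sets (digit_measure m w) = sets (count_space UNIV)"
  by (simp add: digit_measure_def)

lemma space_digit_measure [simp]: "space (digit_measure m w) = UNIV"
  by (simp add: digit_measure_def)

lemma AE_digit_measure_less: "AE j in digit_measure m w. j < m"
  unfolding digit_measure_def by (subst AE_density) (auto simp: AE_count_space)

lemma norm_add_cis_power2:
  "(cmod (a * cis x + b * cis y))^2 = a^2 + b^2 + 2 * a * b * cos (x - y)"
proof -
  have "(cmod (a * cis x + b * cis y))^2
      = a^2 * ((cos x)^2 + (sin x)^2) + b^2 * ((cos y)^2 + (sin y)^2)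
      + 2 * a * b * (cos x * cos y + sin x * sin y)"
    unfolding cmod_power2 by (simp del: sin_cos_squared_add sin_cos_squared_add2) algebra
  then show ?thesis by (simp add: cos_diff)
qed

lemma norm_add_cis_le:
  assumes "0 \<le> a" "0 \<le> b" "0 \<le> \<epsilon>" "\<epsilon> \<le> dist_Ints (x - y)"
  shows "cmod (a * cis (2 * pi * x) + b * cis (2 * pi * y))
    \<le> sqrt ((a + b)^2 - 2 * a * b * (1 - cos (2 * pi * \<epsilon>)))"
proof (rule real_le_rsqrt)
  have "cos (2 * pi * (x - y)) \<le> cos (2 * pi * \<epsilon>)"
    unfolding cos_2pi_dist_Ints[symmetric, of "x - y"]
    using assms(3,4) dist_Ints_le_half[of "x - y"] by (intro cos_monotone_0_pi_le) auto
  then have "2 * a * b * cos (2 * pi * (x - y)) \<le> 2 * a * b * cos (2 * pi * \<epsilon>)"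
    using assms(1,2) by (intro mult_left_mono) auto
  then show "(cmod (a * cis (2 * pi * x) + b * cis (2 * pi * y)))^2
      \<le> (a + b)^2 - 2 * a * b * (1 - cos (2 * pi * \<epsilon>))"
    unfolding norm_add_cis_power2 right_diff_distrib[symmetric]
    by (simp add: power2_eq_square algebra_simps)
qed

context
  fixes m :: nat and w :: "nat \<Rightarrow> real"
  assumes w_pos: "\<And>j. j < m \<Longrightarrow> 0 < w j" and w_sum: "(\<Sum>j<m. w j) = 1"
begin

lemma prob_space_digit_measure: "prob_space (digit_measure m w)"
proof (rule prob_spaceI)
  have "emeasure (digit_measure m w) (space (digit_measure m w)) =
      (\<integral>\<^sup>+j. (if j < m then ennreal (w j) else 0) \<partial>count_space UNIV)"
    by (simp add: digit_measure_def emeasure_density)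
  also have "\<dots> = (\<Sum>j<m. ennreal (w j))"
    by (subst nn_integral_count_space'[where A = "{..<m}"]) auto
  also have "\<dots> = 1" using w_pos w_sum by (subst sum_ennreal) (auto intro: less_imp_le)
  finally show "emeasure (digit_measure m w) (space (digit_measure m w)) = 1" .
qed

lemma integral_digit_measure:
  fixes f :: "nat \<Rightarrow> complex"
  shows "(\<integral>j. f j \<partial>digit_measure m w) = (\<Sum>j<m. w j * f j)"
proof -
  let ?w = "\<lambda>j. if j < m then w j else 0"
  have "digit_measure m w = density (count_space UNIV) (\<lambda>j. ennreal (?w j))"
    unfolding digit_measure_def by (intro arg_cong2[where f = density]) auto
  then have "(\<integral>j. f j \<partial>digit_measure m w) = (\<integral>j. ?w j *\<^sub>R f j \<partial>count_space UNIV)"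
    using w_pos by (simp only:) (subst integral_density, auto simp: less_imp_le)
  also have "\<dots> = (\<Sum>j | j \<in> UNIV \<and> ?w j *\<^sub>R f j \<noteq> 0. ?w j *\<^sub>R f j)"
    by (rule lebesgue_integral_count_space_finite_support, rule finite_subset[of _ "{..<m}"]) auto
  also have "\<dots> = (\<Sum>j<m. ?w j *\<^sub>R f j)" by (rule sum.mono_neutral_left) auto
  also have "\<dots> = (\<Sum>j<m. w j * f j)" by (intro sum.cong) (auto simp: scaleR_conv_of_real)
  finally show ?thesis .
qed

lemma norm_digit_sum_le:
  assumes "A \<subseteq> {..<m}"
  shows "cmod (\<Sum>j\<in>A. w j * cis (y j)) \<le> (\<Sum>j\<in>A. w j)"
proof -
  have "cmod (\<Sum>j\<in>A. w j * cis (y j)) \<le> (\<Sum>j\<in>A. cmod (w j * cis (y j)))" by (rule norm_sum)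
  also have "\<dots> = (\<Sum>j\<in>A. w j)"
    using w_pos assms by (intro sum.cong) (auto simp: norm_mult less_imp_le subset_eq)
  finally show ?thesis .
qed

lemma digit_sum_gap:
  assumes digits: "j1 < m" "j2 < m" "j1 \<noteq> j2" and \<epsilon>_bounds: "0 < \<epsilon>" "\<epsilon> \<le> 1/2"
  obtains \<gamma> where "0 < \<gamma>" "\<gamma> < 1"
    "\<And>y. \<epsilon> \<le> dist_Ints (y j1 - y j2) \<Longrightarrow> cmod (\<Sum>j<m. w j * cis (2 * pi * y j)) \<le> \<gamma>"
proof -
  define g where "g = sqrt ((w j1 + w j2)^2 - 2 * w j1 * w j2 * (1 - cos (2 * pi * \<epsilon>)))"
  have "g < w j1 + w j2"
  proof -
    have "cos (2 * pi * \<epsilon>) < cos 0" using \<epsilon>_bounds by (intro cos_monotone_0_pi) auto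
    then have "g < sqrt ((w j1 + w j2)^2)"
      unfolding g_def using w_pos digits by (intro real_sqrt_less_mono) simp
    then show ?thesis using w_pos[OF digits(1)] w_pos[OF digits(2)] by simp
  qed
  let ?rest = "{..<m} - {j1} - {j2}"
  have split: "(\<Sum>j<m. f j) = (f j1 + f j2) + (\<Sum>j\<in>?rest. f j)" for f :: "nat \<Rightarrow> 'z::comm_monoid_add"
    using digits by (simp add: sum.remove[of _ j1] sum.remove[of _ j2] add.assoc)
  have "cmod (\<Sum>j<m. w j * cis (2 * pi * y j)) \<le> g + (1 - (w j1 + w j2))"
    if far: "\<epsilon> \<le> dist_Ints (y j1 - y j2)" for y
  proof -
    have "cmod (w j1 * cis (2 * pi * y j1) + w j2 * cis (2 * pi * y j2)) \<le> g"
      unfolding g_def using w_pos digits \<epsilon>_bounds far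
      by (intro norm_add_cis_le) (auto intro: less_imp_le)
    moreover have "cmod (\<Sum>j\<in>?rest. w j * cis (2 * pi * y j)) \<le> 1 - (w j1 + w j2)"
      using norm_digit_sum_le[of ?rest "\<lambda>j. 2 * pi * y j"] w_sum split[of w]
      by (simp add: subset_eq)
    ultimately show ?thesis
      unfolding split[of "\<lambda>j. w j * cis (2 * pi * y j)"] by (intro norm_triangle_mono)
  qed
  then show thesis
    using \<open>g < w j1 + w j2\<close>
    by (intro that[of "max (1/2) (g + (1 - (w j1 + w j2)))"]) (auto intro: max.coboundedI2)
qed

end

lemma summable_planar_series:
  fixes k :: "'i::finite \<Rightarrow> nat"
  assumes model: "planar_model k t p lam" and digits: "\<And>n. u n < k (\<omega> n)"
  shows "summable (\<lambda>n. (\<Prod>j<n. lam (\<omega> j)) * t (\<omega> n) (u n))"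
proof -
  define c where "c = Max (range (\<lambda>i. cmod (lam i)))"
  define T where "T = (\<Sum>i\<in>UNIV. \<Sum>j<k i. cmod (t i j))"
  have lam_le: "cmod (lam i) \<le> c" for i unfolding c_def by (rule Max_ge) auto
  have c_bounds: "0 \<le> c" "c < 1"
    using model order_trans[OF norm_ge_zero lam_le] by (auto simp: c_def planar_model_def)
  have t_le: "cmod (t i j) \<le> T" if "j < k i" for i j
  proof -
    have "cmod (t i j) \<le> (\<Sum>j<k i. cmod (t i j))" using that by (intro member_le_sum) auto
    also have "\<dots> \<le> T" unfolding T_def by (rule member_le_sum[of i UNIV]) (auto intro: sum_nonneg)
    finally show ?thesis .
  qed
  have "cmod ((\<Prod>j<n. lam (\<omega> j)) * t (\<omega> n) (u n)) \<le> c ^ n * T" for n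
  proof -
    have "cmod (\<Prod>j<n. lam (\<omega> j)) \<le> (\<Prod>j<n. c)"
      unfolding prod_norm[symmetric] by (intro prod_mono) (auto simp: lam_le)
    then show ?thesis using t_le[OF digits] c_bounds unfolding norm_mult by (intro mult_mono) auto
  qed
  moreover have "summable (\<lambda>n. c ^ n * T)"
    using c_bounds by (intro summable_mult2 summable_geometric) auto
  ultimately show ?thesis by (blast intro: summable_comparison_test')
qed

definition fourier_factor ::
  "('i \<Rightarrow> nat) \<Rightarrow> ('i \<Rightarrow> nat \<Rightarrow> complex) \<Rightarrow> ('i \<Rightarrow> nat \<Rightarrow> real) \<Rightarrow> ('i \<Rightarrow> complex)
     \<Rightarrow> (nat \<Rightarrow> 'i) \<Rightarrow> complex \<Rightarrow> nat \<Rightarrow> complex" where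
  "fourier_factor k t p lam \<omega> \<xi> n = (\<Sum>j<k (\<omega> n). p (\<omega> n) j *
     cis (2 * pi * Re ((\<Prod>i<n. lam (\<omega> i)) * t (\<omega> n) j * cnj \<xi>)))"

lemma norm_fourier_factor_le_1:
  assumes "planar_model k t p lam"
  shows "cmod (fourier_factor k t p lam \<omega> \<xi> n) \<le> 1"
  using norm_digit_sum_le[of "k (\<omega> n)" "p (\<omega> n)" "{..<k (\<omega> n)}"] assms
  unfolding fourier_factor_def planar_model_def by simp

lemma prod_fourier_factor_tendsto:
  fixes k :: "'i::finite \<Rightarrow> nat"
  assumes model: "planar_model k t p lam"
  shows "(\<lambda>N. \<Prod>n<N. fourier_factor k t p lam \<omega> \<xi> n) \<longlonglongrightarrow> fourier_transform (eta k t p lam \<omega>) \<xi>"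
proof -
  define M where "M n = digit_measure (k (\<omega> n)) (p (\<omega> n))" for n
  define x where "x n j = (\<Prod>i<n. lam (\<omega> i)) * t (\<omega> n) j" for n j
  have weights: "\<And>i j. j < k i \<Longrightarrow> 0 < p i j" "\<And>i. (\<Sum>j<k i. p i j) = 1"
    using model by (auto simp: planar_model_def)
  have prob: "prob_space (M n)" for n
    unfolding M_def using weights by (intro prob_space_digit_measure) auto
  have "AE j in M n. j < k (\<omega> n)" for n unfolding M_def by (rule AE_digit_measure_less)
  then have "AE u in PiM UNIV M. u n < k (\<omega> n)" for n
    using AE_PiM_component[of UNIV M n "\<lambda>j. j < k (\<omega> n)"] prob by simp
  then have "AE u in PiM UNIV M. \<forall>n. u n < k (\<omega> n)" by (simp add: AE_all_countable)
  then have "AE u in PiM UNIV M. summable (\<lambda>n. x n (u n))"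
    by eventually_elim (auto simp: x_def intro: summable_planar_series[OF model])
  moreover have "x n \<in> borel_measurable (M n)" for n by (simp add: M_def measurable_def)
  moreover have "fourier_transform (distr (M n) borel (x n)) \<xi> = fourier_factor k t p lam \<omega> \<xi> n"
    for n
    using weights by (subst fourier_transform_distr)
      (simp_all add: M_def measurable_def integral_digit_measure fourier_factor_def x_def)
  ultimately show ?thesis
    using prod_fourier_transform_tendsto[of M x \<xi>] prob
    unfolding eta_def M_def[symmetric] x_def[symmetric] by simp
qed

lemma norm_fourier_transform_eta_le:
  fixes k :: "'i::finite \<Rightarrow> nat"
  assumes model: "planar_model k t p lam"
  shows "cmod (fourier_transform (eta k t p lam \<omega>) \<xi>)
      \<le> (\<Prod>n<N. cmod (fourier_factor k t p lam \<omega> \<xi> n))"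
proof (rule LIMSEQ_le_const2)
  let ?\<phi> = "fourier_factor k t p lam \<omega> \<xi>"
  show "(\<lambda>N'. cmod (\<Prod>n<N'. ?\<phi> n)) \<longlonglongrightarrow> cmod (fourier_transform (eta k t p lam \<omega>) \<xi>)"
    by (rule tendsto_norm[OF prod_fourier_factor_tendsto[OF model]])
  have "cmod (\<Prod>n<N'. ?\<phi> n) \<le> (\<Prod>n<N. cmod (?\<phi> n))" if "N \<le> N'" for N'
    using that
  proof (induction N' rule: dec_induct)
    case (step N')
    have "cmod (\<Prod>n<N'. ?\<phi> n) * cmod (?\<phi> N') \<le> (\<Prod>n<N. cmod (?\<phi> n)) * 1"
      using step.IH norm_fourier_factor_le_1[OF model]
      by (intro mult_mono) (auto intro: prod_nonneg)
    then show ?case by (simp add: norm_mult)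
  qed (simp add: prod_norm)
  then show "\<exists>N0. \<forall>N'\<ge>N0. cmod (\<Prod>n<N'. ?\<phi> n) \<le> (\<Prod>n<N. cmod (?\<phi> n))" by blast
qed

lemma prod_le_power_card_blocks:
  fixes f :: "nat \<Rightarrow> real"
  assumes f_bounds: "\<And>n. 0 \<le> f n" "\<And>n. f n \<le> 1" and \<gamma>_nonneg: "0 \<le> \<gamma>" and A_subset: "A \<subseteq> {..<N}"
    and small: "\<And>m. m \<in> A \<Longrightarrow> \<exists>n\<in>{m * d..<m * d + d}. f n \<le> \<gamma>"
  shows "(\<Prod>n<N * d. f n) \<le> \<gamma> ^ card A"
proof -
  have block: "prod f {m * d..<m * d + d} \<le> (if m \<in> A then \<gamma> else 1)" for m
  proof (cases "m \<in> A")
    case True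
    then obtain n where small_factor: "n \<in> {m * d..<m * d + d}" "f n \<le> \<gamma>" using small by blast
    have "prod f {m * d..<m * d + d} = f n * prod f ({m * d..<m * d + d} - {n})"
      using small_factor(1) by (simp add: prod.remove)
    also have "\<dots> \<le> \<gamma> * 1"
      using small_factor(2) f_bounds \<gamma>_nonneg by (intro mult_mono prod_le_1 prod_nonneg) auto
    finally show ?thesis using True by simp
  qed (simp add: f_bounds prod_le_1)
  have "(\<Prod>n<N * d. f n) = (\<Prod>m<N. prod f {m * d..<m * d + d})"
    by (rule prod.nat_group[symmetric])
  also have "\<dots> \<le> (\<Prod>m<N. if m \<in> A then \<gamma> else 1)"
    using block f_bounds by (intro prod_mono) (auto intro: prod_nonneg)
  also have "\<dots> = (\<Prod>m\<in>{m\<in>{..<N}. m \<in> A}. \<gamma>)" by (subst prod.inter_filter) auto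
  also have "{m\<in>{..<N}. m \<in> A} = A" using A_subset by blast
  finally show ?thesis by simp
qed

lemma D2_geometric_scales:
  assumes R_gt_1: "1 < R" and \<gamma>_bounds: "0 < \<gamma>" "\<gamma> < 1" and a_pos: "0 < a" and B_nonneg: "0 \<le> B"
    and decay: "\<And>\<xi>. 1 \<le> cmod \<xi> \<Longrightarrow> \<exists>N. a * cmod \<xi> \<le> R ^ N \<and> cmod (fourier_transform \<mu> \<xi>) \<le> B * \<gamma> ^ N"
  shows "\<mu> \<in> D2"
proof -
  define \<sigma> where "\<sigma> = - log R \<gamma>"
  have \<sigma>_pos: "0 < \<sigma>" unfolding \<sigma>_def using R_gt_1 \<gamma>_bounds by simp
  have "cmod (fourier_transform \<mu> \<xi>) \<le> B * a powr (- \<sigma>) * cmod \<xi> powr (- \<sigma>)"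
    if \<xi>_ge_1: "1 \<le> cmod \<xi>" for \<xi>
  proof -
    obtain N where scale: "a * cmod \<xi> \<le> R ^ N" "cmod (fourier_transform \<mu> \<xi>) \<le> B * \<gamma> ^ N"
      using decay[OF \<xi>_ge_1] by blast
    have "\<gamma> ^ N = (R powr (- \<sigma>)) ^ N" using R_gt_1 \<gamma>_bounds by (simp add: \<sigma>_def)
    also have "\<dots> = (R ^ N) powr (- \<sigma>)"
      using R_gt_1 by (simp add: powr_realpow[symmetric] powr_powr mult.commute)
    also have "\<dots> \<le> (a * cmod \<xi>) powr (- \<sigma>)"
      using scale(1) a_pos \<xi>_ge_1 \<sigma>_pos by (intro powr_mono2') (auto intro!: mult_pos_pos)
    also have "\<dots> = a powr (- \<sigma>) * cmod \<xi> powr (- \<sigma>)" using a_pos by (simp add: powr_mult)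
    finally have "B * \<gamma> ^ N \<le> B * (a powr (- \<sigma>) * cmod \<xi> powr (- \<sigma>))"
      using B_nonneg by (rule mult_left_mono)
    then show ?thesis using scale(2) by simp
  qed
  then have "\<mu> \<in> D2_sigma \<sigma>" unfolding D2_sigma_def by blast
  then show ?thesis unfolding D2_def using \<sigma>_pos by blast
qed

section \<open>Exponents near a fixed one\<close>

locale exponent_region =
  fixes \<beta> :: "'i::finite \<Rightarrow> complex" and i0 :: 'i and V :: "complex set" and c L M \<delta> C :: real
  assumes convex: "convex V" and nonempty: "V \<noteq> {}"
    and Re_neg: "\<And>s. s \<in> V \<Longrightarrow> Re s < 0"
    and norm_\<beta>_le: "\<And>i. cmod (\<beta> i) \<le> M"
    and c_bounds: "0 < c" "c < 1"
    and L_gt_1: "1 < L"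
    and C_pos: "0 < C"
    and \<delta>_pos: "0 < \<delta>"
    and contraction: "\<And>i s. s \<in> V \<Longrightarrow> cmod (exp (\<beta> i * s)) \<le> c"
    and expansion: "\<And>i s. s \<in> V \<Longrightarrow> cmod (exp (- \<beta> i * s)) \<le> L"
    and nonreal: "\<And>s. s \<in> V \<Longrightarrow> \<delta> \<le> \<bar>Im (exp (\<beta> i0 * s))\<bar>"
    and same_side: "\<And>s s'. s \<in> V \<Longrightarrow> s' \<in> V \<Longrightarrow> 0 < Im (exp (\<beta> i0 * s)) * Im (exp (\<beta> i0 * s'))"
    and inverse_lipschitz: "\<And>s s'. s \<in> V \<Longrightarrow> s' \<in> V \<Longrightarrow>
      cmod (s - s') \<le> C * cmod (exp (\<beta> i0 * s) - exp (\<beta> i0 * s'))"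
begin

lemma M_nonneg: "0 \<le> M"
  using norm_\<beta>_le norm_ge_zero order_trans by blast

lemma norm_exp_le_1: "s \<in> V \<Longrightarrow> cmod (exp (\<beta> i * s)) \<le> 1"
  using contraction[of s i] c_bounds by linarith

lemma norm_exp_sum_le:
  assumes "s \<in> V" "finite A"
  shows "cmod (exp (s * (\<Sum>j\<in>A. \<beta> (\<omega> j)))) \<le> c ^ card A"
    and "cmod (exp (s * (- (\<Sum>j\<in>A. \<beta> (\<omega> j))))) \<le> L ^ card A"
proof -
  have "exp (s * (\<Sum>j\<in>A. \<beta> (\<omega> j))) = (\<Prod>j\<in>A. exp (\<beta> (\<omega> j) * s))"
    using assms(2) by (simp add: sum_distrib_left exp_sum mult.commute)
  then show "cmod (exp (s * (\<Sum>j\<in>A. \<beta> (\<omega> j)))) \<le> c ^ card A"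
    using prod_mono[of A "\<lambda>j. cmod (exp (\<beta> (\<omega> j) * s))" "\<lambda>_. c"] contraction[OF assms(1)]
    by (simp add: prod_norm[symmetric])
  have "exp (s * (- (\<Sum>j\<in>A. \<beta> (\<omega> j)))) = (\<Prod>j\<in>A. exp (- \<beta> (\<omega> j) * s))"
    using assms(2) by (simp add: sum_distrib_left exp_sum mult.commute flip: sum_negf)
  then show "cmod (exp (s * (- (\<Sum>j\<in>A. \<beta> (\<omega> j))))) \<le> L ^ card A"
    using prod_mono[of A "\<lambda>j. cmod (exp (- \<beta> (\<omega> j) * s))" "\<lambda>_. L"] expansion[OF assms(1)]
    by (simp add: prod_norm[symmetric])
qed

definition freq :: "(nat \<Rightarrow> 'i) \<Rightarrow> complex \<times> complex \<Rightarrow> nat \<Rightarrow> complex" where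
  "freq \<omega> p n = snd p * exp (fst p * (\<Sum>j<n. \<beta> (\<omega> j)))"

lemma freq_0 [simp]: "freq \<omega> p 0 = snd p"
  by (simp add: freq_def)

lemma freq_eq_prod: "freq \<omega> (s, \<zeta>) n = \<zeta> * (\<Prod>j<n. exp (\<beta> (\<omega> j) * s))"
  by (simp add: freq_def sum_distrib_left exp_sum mult.commute)

lemma freq_later:
  assumes "n \<le> n'"
  shows "freq \<omega> p n' = freq \<omega> p n * exp (fst p * (\<Sum>j\<in>{n..<n'}. \<beta> (\<omega> j)))"
proof -
  have "(\<Sum>j<n'. \<beta> (\<omega> j)) = (\<Sum>j<n. \<beta> (\<omega> j)) + (\<Sum>j\<in>{n..<n'}. \<beta> (\<omega> j))"
    using sum.atLeastLessThan_concat[of 0 n n' "\<lambda>j. \<beta> (\<omega> j)"] assms by (simp add: lessThan_atLeast0)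
  then show ?thesis by (simp add: freq_def distrib_left exp_add)
qed

lemma freq_earlier:
  assumes "n \<le> n'"
  shows "freq \<omega> p n = freq \<omega> p n' * exp (fst p * (- (\<Sum>j\<in>{n..<n'}. \<beta> (\<omega> j))))"
  unfolding freq_later[OF assms] by (simp add: mult.assoc flip: exp_add)

lemma norm_freq_later_le:
  assumes "fst p \<in> V" "n \<le> n'"
  shows "cmod (freq \<omega> p n') \<le> cmod (freq \<omega> p n) * c ^ (n' - n)"
  unfolding freq_later[OF assms(2)] norm_mult
  using norm_exp_sum_le(1)[OF assms(1), of "{n..<n'}" \<omega>] by (intro mult_left_mono) auto

lemma norm_freq_earlier_le:
  assumes "fst p \<in> V" "n \<le> n'"
  shows "cmod (freq \<omega> p n) \<le> cmod (freq \<omega> p n') * L ^ (n' - n)"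
  unfolding freq_earlier[OF assms(2)] norm_mult
  using norm_exp_sum_le(2)[OF assms(1), of "{n..<n'}" \<omega>] by (intro mult_left_mono) auto

lemma freq_cong: "(\<And>j. j < n \<Longrightarrow> \<omega> j = \<omega>' j) \<Longrightarrow> freq \<omega> p n = freq \<omega>' p n"
  unfolding freq_def by (metis (no_types, lifting) lessThan_iff sum.cong)

definition shift_exponent :: "(nat \<Rightarrow> 'i) \<Rightarrow> nat \<Rightarrow> nat \<Rightarrow> nat \<Rightarrow> complex" where
  "shift_exponent \<omega> j n n' = of_nat j * \<beta> i0 - (\<Sum>i\<in>{n..<n'}. \<beta> (\<omega> i))"

lemma exp_shift_exponent:
  "exp (s * shift_exponent \<omega> j n n') = exp (s * (- (\<Sum>i\<in>{n..<n'}. \<beta> (\<omega> i)))) * exp (\<beta> i0 * s) ^ j"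
  by (simp add: shift_exponent_def exp_of_nat_mult[symmetric] exp_add[symmetric] algebra_simps)

lemma freq_mult_power:
  assumes "n \<le> n'"
  shows "freq \<omega> p n * exp (\<beta> i0 * fst p) ^ j = freq \<omega> p n' * exp (fst p * shift_exponent \<omega> j n n')"
  unfolding freq_earlier[OF assms] exp_shift_exponent by (simp only: mult.assoc)

lemma norm_shift_exponent_le: "cmod (shift_exponent \<omega> j n n') \<le> (j + real (n' - n)) * M"
proof -
  have "cmod (shift_exponent \<omega> j n n') \<le> j * cmod (\<beta> i0) + (\<Sum>i\<in>{n..<n'}. cmod (\<beta> (\<omega> i)))"
    unfolding shift_exponent_def
    using norm_triangle_ineq4[of "of_nat j * \<beta> i0" "\<Sum>i\<in>{n..<n'}. \<beta> (\<omega> i)"]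
      norm_sum[of "\<lambda>i. \<beta> (\<omega> i)" "{n..<n'}"]
    by (simp add: norm_mult)
  also have "\<dots> \<le> j * M + (\<Sum>i\<in>{n..<n'}. M)"
    using norm_\<beta>_le by (intro add_mono mult_left_mono sum_mono) auto
  finally show ?thesis by (simp add: algebra_simps)
qed

lemma norm_exp_shift_exponent_le:
  assumes "s \<in> V"
  shows "cmod (exp (s * shift_exponent \<omega> j n n')) \<le> L ^ (n' - n)"
proof -
  have "cmod (exp (\<beta> i0 * s)) ^ j \<le> 1" using norm_exp_le_1[OF assms] by (intro power_le_one) auto
  then have "cmod (exp (s * shift_exponent \<omega> j n n')) \<le> L ^ card {n..<n'} * 1"
    unfolding exp_shift_exponent norm_mult norm_power
    using norm_exp_sum_le(2)[OF assms, of "{n..<n'}" \<omega>] L_gt_1 by (intro mult_mono) auto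
  then show ?thesis by simp
qed

definition stability :: real where
  "stability = 15 * max 1 C / \<delta>^4"

lemma \<delta>_le_1: "\<delta> \<le> 1"
proof -
  obtain s where s_in_V: "s \<in> V" using nonempty by blast
  show ?thesis
    using nonreal[OF s_in_V] abs_Im_le_cmod[of "exp (\<beta> i0 * s)"] norm_exp_le_1[OF s_in_V, of i0]
    by linarith
qed

lemma stability_ge_1: "1 \<le> stability"
proof -
  have "\<delta>^4 \<le> 1" using \<delta>_pos \<delta>_le_1 by (simp add: power_le_one)
  then show ?thesis unfolding stability_def using \<delta>_pos by (simp add: le_divide_eq)
qed

lemma exponent_and_amplitude_stable:
  assumes in_V: "s \<in> V" "s' \<in> V"
    and near: "\<And>j. j < 4 \<Longrightarrow> \<bar>Re (u * exp (\<beta> i0 * s) ^ j) - Re (u' * exp (\<beta> i0 * s') ^ j)\<bar> \<le> e"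
  shows "cmod (s - s') * cmod u' \<le> stability * e" and "cmod (u - u') \<le> stability * e"
proof -
  let ?z = "exp (\<beta> i0 * s)" and ?z' = "exp (\<beta> i0 * s')"
  note observed = norm_exp_le_1[OF in_V(1)] norm_exp_le_1[OF in_V(2)] \<delta>_pos nonreal[OF in_V(1)]
    nonreal[OF in_V(2)]
    same_side[OF in_V] near
  have e_nonneg: "0 \<le> e" using near[of 0] by simp
  have "cmod (s - s') * cmod u' \<le> C * (cmod (?z - ?z') * cmod u')"
    using mult_right_mono[OF inverse_lipschitz[OF in_V], of "cmod u'"] by (simp add: mult.assoc)
  also have "\<dots> \<le> C * (12 * e / \<delta>^3)"
    using multiplier_stable[OF observed] C_pos by (intro mult_left_mono) auto
  also have "\<dots> \<le> max 1 C * (15 * e / \<delta>^4)"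
  proof (intro mult_mono frac_le)
    show "\<delta>^4 \<le> \<delta>^3" using \<delta>_pos \<delta>_le_1 by (intro power_decreasing) auto
  qed (use e_nonneg \<delta>_pos C_pos in auto)
  finally show "cmod (s - s') * cmod u' \<le> stability * e" by (simp add: stability_def mult_ac)
  have "15 * e / \<delta>^4 \<le> max 1 C * (15 * e / \<delta>^4)"
    using e_nonneg \<delta>_pos mult_right_mono[of 1 "max 1 C" "15 * e / \<delta>^4"] by simp
  then show "cmod (u - u') \<le> stability * e"
    using amplitude_stable[OF observed] by (simp add: stability_def mult_ac)
qed

lemma exp_mult_lipschitz:
  assumes in_V: "s \<in> V" "s' \<in> V" and norm_w_le: "cmod w \<le> B"
    and norm_exp_le: "\<And>z. z \<in> V \<Longrightarrow> cmod (exp (z * w)) \<le> E"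
  shows "cmod (exp (s * w) - exp (s' * w)) \<le> B * E * cmod (s - s')"
proof (rule field_differentiable_bound[OF convex _ _ in_V])
  fix z assume "z \<in> V"
  show "((\<lambda>z. exp (z * w)) has_field_derivative exp (z * w) * w) (at z within V)"
    by (auto intro!: derivative_eq_intros)
  show "cmod (exp (z * w) * w) \<le> B * E"
    using norm_exp_le[OF \<open>z \<in> V\<close>] norm_w_le order_trans[OF norm_ge_zero norm_w_le]
    by (simp add: norm_mult mult.commute mult_mono)
qed

lemma mult_exp_stable:
  assumes in_V: "s \<in> V" "s' \<in> V"
    and near: "\<And>j. j < 4 \<Longrightarrow> \<bar>Re (u * exp (\<beta> i0 * s) ^ j) - Re (u' * exp (\<beta> i0 * s') ^ j)\<bar> \<le> e"
    and norm_w_le: "cmod w \<le> B" and norm_exp_le: "\<And>z. z \<in> V \<Longrightarrow> cmod (exp (z * w)) \<le> E"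
  shows "cmod (u * exp (s * w) - u' * exp (s' * w)) \<le> stability * (1 + B) * E * e"
proof -
  note stable = exponent_and_amplitude_stable[OF in_V near]
  have "0 \<le> E" using norm_exp_le[OF in_V(1)] norm_ge_zero order_trans by blast
  have "0 \<le> B" using norm_w_le norm_ge_zero order_trans by blast
  have "u * exp (s * w) - u' * exp (s' * w)
      = (u - u') * exp (s * w) + u' * (exp (s * w) - exp (s' * w))"
    by (simp add: algebra_simps)
  also have "cmod \<dots>
      \<le> cmod (u - u') * cmod (exp (s * w)) + cmod u' * cmod (exp (s * w) - exp (s' * w))"
    by (metis norm_mult norm_triangle_ineq)
  also have "\<dots> \<le> (stability * e) * E + cmod u' * (B * E * cmod (s - s'))"
    using stable(2) norm_exp_le[OF in_V(1)] order_trans[OF norm_ge_zero stable(2)]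
      exp_mult_lipschitz[OF in_V norm_w_le norm_exp_le]
    by (intro add_mono mult_mono) auto
  also have "cmod u' * (B * E * cmod (s - s')) = B * E * (cmod (s - s') * cmod u')"
    by (simp only: mult_ac)
  also have "\<dots> \<le> B * E * (stability * e)"
    using stable(1) \<open>0 \<le> B\<close> \<open>0 \<le> E\<close> by (intro mult_left_mono) auto
  finally show ?thesis by (simp add: algebra_simps)
qed

definition error_growth :: "nat \<Rightarrow> real" where
  "error_growth b = stability * (1 + (8 * b + 3) * M) * L ^ (8 * b)"

lemma error_growth_ge: "L ^ (8 * b) \<le> error_growth b" and error_growth_ge_1: "1 \<le> error_growth b"
proof -
  have "1 * 1 * L ^ (8 * b) \<le> stability * (1 + (8 * b + 3) * M) * L ^ (8 * b)"
    using stability_ge_1 M_nonneg L_gt_1 by (intro mult_mono) auto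
  then show "L ^ (8 * b) \<le> error_growth b" unfolding error_growth_def by simp
  then show "1 \<le> error_growth b" using one_le_power[of L "8 * b"] L_gt_1 by linarith
qed

definition branching :: "nat \<Rightarrow> real" where
  "branching b = (2 * error_growth b + 2) ^ 4"

lemma branching_ge_1: "1 \<le> branching b"
  unfolding branching_def using error_growth_ge_1[of b] by (intro one_le_power) simp

lemma branching_le_exponential:
  obtains A Y where "1 \<le> A" "1 \<le> Y" "\<And>b. branching b \<le> A * Y ^ b"
proof
  let ?A = "4 * stability * (1 + M) ^ 3"
  have "1 * 1 \<le> (4 * stability) * (1 + M) ^ 3"
    using stability_ge_1 M_nonneg by (intro mult_mono one_le_power) auto
  then show "1 \<le> ?A ^ 4" by (intro one_le_power) simp
  have "1 * 1 \<le> (1 + M) * L" using M_nonneg L_gt_1 by (intro mult_mono) auto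
  then show "1 \<le> ((1 + M) * L) ^ 32" by (intro one_le_power) simp
  show "branching b \<le> ?A ^ 4 * (((1 + M) * L) ^ 32) ^ b" for b
  proof -
    have "1 + real (8 * b + 3) * M \<le> (1 + M) ^ (8 * b + 3)"
      using M_nonneg Bernoulli_inequality[of M "8 * b + 3"] by linarith
    then have "error_growth b \<le> stability * (1 + M) ^ (8 * b + 3) * L ^ (8 * b)"
      unfolding error_growth_def using stability_ge_1 L_gt_1
      by (intro mult_right_mono mult_left_mono) auto
    then have "2 * error_growth b + 2 \<le> 4 * (stability * (1 + M) ^ (8 * b + 3) * L ^ (8 * b))"
      using error_growth_ge_1[of b] by linarith
    also have "\<dots> = ?A * ((1 + M) * L) ^ (8 * b)"
      by (simp add: power_add power_mult_distrib)
    finally have "branching b \<le> (?A * ((1 + M) * L) ^ (8 * b)) ^ 4"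
      unfolding branching_def using error_growth_ge_1[of b] by (intro power_mono) auto
    also have "\<dots> = ?A ^ 4 * (((1 + M) * L) ^ 32) ^ b"
      by (simp add: power_mult_distrib flip: power_mult)
    finally show ?thesis .
  qed
qed

end

section \<open>Observations in blocks\<close>

definition constant_quadruple :: "'i \<Rightarrow> (nat \<Rightarrow> 'i) \<Rightarrow> nat \<Rightarrow> bool" where
  "constant_quadruple i \<omega> k \<longleftrightarrow> (\<forall>n\<in>{4 * k..<4 * k + 4}. \<omega> n = i)"

definition good_block :: "'i \<Rightarrow> nat \<Rightarrow> (nat \<Rightarrow> 'i) \<Rightarrow> nat \<Rightarrow> bool" where
  "good_block i b \<omega> m \<longleftrightarrow> (\<exists>k\<in>{m * b..<Suc m * b}. constant_quadruple i \<omega> k)"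

definition quadruple_start :: "'i \<Rightarrow> nat \<Rightarrow> (nat \<Rightarrow> 'i) \<Rightarrow> nat \<Rightarrow> nat" where
  "quadruple_start i b \<omega> m = 4 * (if good_block i b \<omega> m
     then LEAST k. k \<in> {m * b..<Suc m * b} \<and> constant_quadruple i \<omega> k else m * b)"

lemma good_block_quadruple_startE:
  assumes "good_block i b \<omega> m"
  obtains k where
    "quadruple_start i b \<omega> m = 4 * k" "k \<in> {m * b..<Suc m * b}" "constant_quadruple i \<omega> k"
proof -
  have "\<exists>k. k \<in> {m * b..<Suc m * b} \<and> constant_quadruple i \<omega> k"
    using assms unfolding good_block_def by blast
  from LeastI_ex[OF this] show thesis using that assms by (simp add: quadruple_start_def)
qed

lemma letter_at_quadruple_start:
  assumes "good_block i b \<omega> m" "j < 4"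
  shows "\<omega> (quadruple_start i b \<omega> m + j) = i"
  using assms by (auto elim!: good_block_quadruple_startE simp: constant_quadruple_def)

lemma quadruple_start_bounds:
  assumes "1 \<le> b"
  shows "4 * b * m \<le> quadruple_start i b \<omega> m \<and> quadruple_start i b \<omega> m + 4 \<le> 4 * b * Suc m"
proof (cases "good_block i b \<omega> m")
  case True
  then show ?thesis by (rule good_block_quadruple_startE) (simp add: algebra_simps)
qed (use assms in \<open>simp add: quadruple_start_def algebra_simps\<close>)

lemma constant_quadruple_cong:
  "(\<And>j. j < 4 * Suc k \<Longrightarrow> \<omega> j = \<omega>' j) \<Longrightarrow> constant_quadruple i \<omega> k = constant_quadruple i \<omega>' k"
  unfolding constant_quadruple_def by simp

lemma
  assumes "\<And>j. j < 4 * b * Suc m \<Longrightarrow> \<omega> j = \<omega>' j"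
  shows good_block_cong: "good_block i b \<omega> m = good_block i b \<omega>' m"
    and quadruple_start_cong: "quadruple_start i b \<omega> m = quadruple_start i b \<omega>' m"
proof -
  have quadruple: "constant_quadruple i \<omega> k = constant_quadruple i \<omega>' k"
    if "k \<in> {m * b..<Suc m * b}" for k
  proof (rule constant_quadruple_cong, rule assms)
    fix j assume "j < 4 * Suc k"
    also have "\<dots> \<le> 4 * (Suc m * b)" using that by (intro mult_le_mono2) auto
    finally show "j < 4 * b * Suc m" by (simp add: algebra_simps)
  qed
  then show good: "good_block i b \<omega> m = good_block i b \<omega>' m" unfolding good_block_def by blast
  have "(\<lambda>k. k \<in> {m * b..<Suc m * b} \<and> constant_quadruple i \<omega> k)
      = (\<lambda>k. k \<in> {m * b..<Suc m * b} \<and> constant_quadruple i \<omega>' k)"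
    using quadruple by blast
  then show "quadruple_start i b \<omega> m = quadruple_start i b \<omega>' m"
    unfolding quadruple_start_def good by presburger
qed

section \<open>The Erdos--Kahane counting argument\<close>

lemma dist_exp_le_dist:
  assumes "Re s \<le> 0" "Re s' \<le> 0"
  shows "dist (exp s) (exp s') \<le> dist s s'"
proof -
  have "norm (exp s - exp s') \<le> 1 * norm (s - s')"
  proof (rule field_differentiable_bound[of "{z. Re z \<le> 0}" exp exp])
    show "convex {z. Re z \<le> 0}" by (rule convex_halfspace_Re_le)
    show "(exp has_field_derivative exp z) (at z within {z. Re z \<le> 0})" for z :: complex
      by (auto intro!: derivative_eq_intros)
  qed (use assms in auto)
  then show ?thesis by (simp add: dist_norm)
qed

locale erdos_kahane = exponent_region +
  fixes b :: nat and \<kappa> :: real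
  assumes b_ge_1: "1 \<le> b" and \<kappa>_pos: "0 < \<kappa>"
    and rate: "2 * branching b powr (4 * \<kappa>) * c ^ (4 * b) \<le> 1 / 2"
begin

abbreviation good :: "(nat \<Rightarrow> 'a) \<Rightarrow> nat \<Rightarrow> bool" where
  "good \<equiv> good_block i0 b"

abbreviation start :: "(nat \<Rightarrow> 'a) \<Rightarrow> nat \<Rightarrow> nat" where
  "start \<equiv> quadruple_start i0 b"

text \<open>In a block that is not good, the observations do not correspond to factors of the Fourier
  transform. They are only used to transport information between the neighbouring blocks.\<close>

definition observation :: "(nat \<Rightarrow> 'a) \<Rightarrow> complex \<times> complex \<Rightarrow> nat \<Rightarrow> nat \<Rightarrow> real" where
  "observation \<omega> p m j = Re (freq \<omega> p (start \<omega> m) * exp (\<beta> i0 * fst p) ^ j)"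

definition tolerance :: real where
  "tolerance = 1 / (4 * (error_growth b + 1))"

definition near_integers :: "(nat \<Rightarrow> 'a) \<Rightarrow> complex \<times> complex \<Rightarrow> nat \<Rightarrow> bool" where
  "near_integers \<omega> p m \<longleftrightarrow> (\<forall>j<4. dist_Ints (observation \<omega> p m j) \<le> tolerance)"

definition code :: "(nat \<Rightarrow> 'a) \<Rightarrow> complex \<times> complex \<Rightarrow> nat \<Rightarrow> nat \<Rightarrow> int" where
  "code \<omega> p m = (\<lambda>j\<in>{..<4}. round (observation \<omega> p m j))"

lemma tolerance_pos: "0 < tolerance" and tolerance_le_half: "tolerance \<le> 1/2"
  using error_growth_ge_1[of b] by (auto simp: tolerance_def field_simps)

lemma code_eqD:
  assumes "code \<omega> p m = code \<omega> p' m" "j < 4"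
  shows "round (observation \<omega> p m j) = round (observation \<omega> p' m j)"
  using fun_cong[OF assms(1), of j] assms(2) by (simp add: code_def)

lemma observation_earlier_stable:
  assumes in_V: "fst p \<in> V" "fst p' \<in> V"
    and near: "\<And>j. j < 4 \<Longrightarrow> \<bar>observation \<omega> p (Suc m) j - observation \<omega> p' (Suc m) j\<bar> \<le> e"
    and j_less: "j < 4"
  shows "\<bar>observation \<omega> p m j - observation \<omega> p' m j\<bar> \<le> error_growth b * e"
proof -
  let ?n = "start \<omega> m" and ?n' = "start \<omega> (Suc m)"
  let ?w = "shift_exponent \<omega> j ?n ?n'"
  have order: "?n \<le> ?n'" and gap: "?n' - ?n \<le> 8 * b"
    using quadruple_start_bounds[OF b_ge_1, of m i0 \<omega>]
      quadruple_start_bounds[OF b_ge_1, of "Suc m" i0 \<omega>]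
    by (auto simp: algebra_simps)
  have "cmod ?w \<le> (j + real (?n' - ?n)) * M" by (rule norm_shift_exponent_le)
  also have "\<dots> \<le> (8 * b + 3) * M" using j_less gap M_nonneg by (intro mult_right_mono) auto
  finally have norm_w_le: "cmod ?w \<le> (8 * b + 3) * M" .
  have exp_w: "cmod (exp (s * ?w)) \<le> L ^ (8 * b)" if "s \<in> V" for s
    using norm_exp_shift_exponent_le[OF that, of \<omega> j ?n ?n'] power_increasing[OF gap, of L] L_gt_1
    by linarith
  have observation: "observation \<omega> p m j = Re (freq \<omega> p ?n' * exp (fst p * ?w))" for p
    unfolding observation_def freq_mult_power[OF order] ..
  have "\<bar>observation \<omega> p m j - observation \<omega> p' m j\<bar>
      \<le> cmod (freq \<omega> p ?n' * exp (fst p * ?w) - freq \<omega> p' ?n' * exp (fst p' * ?w))"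
    unfolding observation minus_complex.simps(1)[symmetric] by (rule abs_Re_le_cmod)
  also have "\<dots> \<le> stability * (1 + (8 * b + 3) * M) * L ^ (8 * b) * e"
    using near unfolding observation_def by (rule mult_exp_stable[OF in_V _ norm_w_le exp_w])
  finally show ?thesis by (simp add: error_growth_def)
qed

lemma code_image_bounded:
  assumes "\<And>p j. p \<in> G \<Longrightarrow> j < 4 \<Longrightarrow> \<bar>observation \<omega> p m j - y j\<bar> \<le> error_growth b"
  shows "finite ((\<lambda>p. code \<omega> p m) ` G)" and "real (card ((\<lambda>p. code \<omega> p m) ` G)) \<le> branching b"
proof -
  let ?S = "(\<lambda>p. code \<omega> p m) ` G"
  have "\<bar>of_int (round (observation \<omega> p m j)) - y j\<bar> \<le> error_growth b + 1/2"
    if "p \<in> G" "j < 4" for p j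
    using assms[OF that] of_int_round_abs_le[of "observation \<omega> p m j"] by linarith
  then have "?S \<subseteq> (\<Pi>\<^sub>E j\<in>{..<4}. {k::int. \<bar>of_int k - y j\<bar> \<le> error_growth b + 1/2})"
    by (simp add: code_def image_subset_iff restrict_PiE_iff)
  from card_int_vectors_near[OF _ _ this]
  have "finite ?S \<and> real (card ?S) \<le> (2 * (error_growth b + 1/2) + 1) ^ card {..<4::nat}"
    using error_growth_ge_1[of b] by simp
  then show "finite ?S" "real (card ?S) \<le> branching b"
    by (simp_all add: branching_def algebra_simps)
qed

lemma observation_near_if_code_eq:
  assumes "code \<omega> p m = code \<omega> p' m" "j < 4"
  shows "\<bar>observation \<omega> p m j - observation \<omega> p' m j\<bar> \<le> 1"
  using abs_diff_le_if_round_eq[OF code_eqD[OF assms]] dist_Ints_le_half[of "observation \<omega> p m j"]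
    dist_Ints_le_half[of "observation \<omega> p' m j"]
  by linarith

lemma code_earlier_bounded:
  assumes in_V: "\<And>p. p \<in> G \<Longrightarrow> fst p \<in> V"
    and same: "\<And>p. p \<in> G \<Longrightarrow> code \<omega> p (Suc m) = code \<omega> p0 (Suc m)" and p0_in: "p0 \<in> G"
  shows "finite ((\<lambda>p. code \<omega> p m) ` G)" and "real (card ((\<lambda>p. code \<omega> p m) ` G)) \<le> branching b"
proof -
  have near: "\<bar>observation \<omega> p m j - observation \<omega> p0 m j\<bar> \<le> error_growth b"
    if "p \<in> G" "j < 4" for p j
    using observation_earlier_stable[OF in_V[OF that(1)] in_V[OF p0_in] _ that(2), of \<omega> m 1]
      observation_near_if_code_eq[OF same[OF that(1)]] by simp
  show "finite ((\<lambda>p. code \<omega> p m) ` G)" "real (card ((\<lambda>p. code \<omega> p m) ` G)) \<le> branching b"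
    using code_image_bounded[of G \<omega> m "observation \<omega> p0 m"] near by blast+
qed

lemma code_earlier_unique:
  assumes in_V: "fst p \<in> V" "fst p' \<in> V" and same: "code \<omega> p (Suc m) = code \<omega> p' (Suc m)"
    and near: "near_integers \<omega> p (Suc m)" "near_integers \<omega> p' (Suc m)" "near_integers \<omega> p m"
      "near_integers \<omega> p' m"
  shows "code \<omega> p m = code \<omega> p' m"
  unfolding code_def
proof (rule restrict_ext)
  fix j :: nat assume "j \<in> {..<4}"
  then have j_less: "j < 4" by simp
  have "\<bar>observation \<omega> p (Suc m) i - observation \<omega> p' (Suc m) i\<bar> \<le> 2 * tolerance" if "i < 4" for i
    using abs_diff_le_if_round_eq[OF code_eqD[OF same that]] near(1,2) that
    unfolding near_integers_def by fastforce
  then have "\<bar>observation \<omega> p m j - observation \<omega> p' m j\<bar> \<le> error_growth b * (2 * tolerance)"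
    using in_V j_less by (intro observation_earlier_stable)
  then have "dist_Ints (observation \<omega> p m j) + \<bar>observation \<omega> p m j - observation \<omega> p' m j\<bar>
      + dist_Ints (observation \<omega> p' m j) \<le> 2 * tolerance * (error_growth b + 1)"
    using near(3,4) j_less unfolding near_integers_def by (fastforce simp: algebra_simps)
  also have "\<dots> < 1" using error_growth_ge_1[of b] by (simp add: tolerance_def divide_simps)
  finally show "round (observation \<omega> p m j) = round (observation \<omega> p' m j)"
    by (rule round_eq_if_near)
qed

definition normalized :: "(nat \<Rightarrow> 'a) \<Rightarrow> nat \<Rightarrow> (complex \<times> complex) set" where
  "normalized \<omega> N = {p. fst p \<in> V \<and> cmod (freq \<omega> p (4 * b * N)) \<in> {1..L ^ (4 * b)}}"

lemma code_first_bounded: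
  assumes normalized: "G \<subseteq> normalized \<omega> (Suc m)"
  shows "finite ((\<lambda>p. code \<omega> p m) ` G)" and "real (card ((\<lambda>p. code \<omega> p m) ` G)) \<le> branching b"
proof -
  have near: "\<bar>observation \<omega> p m j - 0\<bar> \<le> error_growth b" if "p \<in> G" for p j
  proof -
    let ?n = "start \<omega> m"
    have p_bounds: "fst p \<in> V" "cmod (freq \<omega> p (4 * b * Suc m)) \<le> L ^ (4 * b)"
      using that normalized by (auto simp: normalized_def)
    have start_bounds: "?n \<le> 4 * b * Suc m" "4 * b * Suc m - ?n \<le> 4 * b"
      using quadruple_start_bounds[OF b_ge_1, of m i0 \<omega>] by (auto simp: algebra_simps)
    have "\<bar>observation \<omega> p m j\<bar> \<le> cmod (freq \<omega> p ?n) * cmod (exp (\<beta> i0 * fst p)) ^ j"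
      unfolding observation_def norm_power[symmetric] norm_mult[symmetric] by (rule abs_Re_le_cmod)
    also have "\<dots> \<le> cmod (freq \<omega> p ?n) * 1"
      using norm_exp_le_1[OF p_bounds(1)] by (intro mult_left_mono power_le_one) auto
    also have "\<dots> \<le> cmod (freq \<omega> p (4 * b * Suc m)) * L ^ (4 * b * Suc m - ?n)"
      using norm_freq_earlier_le[OF p_bounds(1) start_bounds(1)] by simp
    also have "\<dots> \<le> L ^ (4 * b) * L ^ (4 * b)"
      using p_bounds(2) start_bounds(2) L_gt_1 by (intro mult_mono power_increasing) auto
    also have "\<dots> = L ^ (8 * b)" by (simp flip: power_add)
    also have "\<dots> \<le> error_growth b" by (rule error_growth_ge)
    finally show ?thesis by simp
  qed
  show "finite ((\<lambda>p. code \<omega> p m) ` G)" "real (card ((\<lambda>p. code \<omega> p m) ` G)) \<le> branching b"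
    using code_image_bounded[of G \<omega> m "\<lambda>_. 0"] near by blast+
qed

definition uncontrolled :: "(nat \<Rightarrow> 'a) \<Rightarrow> nat \<Rightarrow> complex \<times> complex \<Rightarrow> nat set" where
  "uncontrolled \<omega> N p = {m. m < N \<and> \<not> (good \<omega> m \<and> near_integers \<omega> p m)}"

lemma near_integers_if_controlled: "m < N \<Longrightarrow> m \<notin> uncontrolled \<omega> N p \<Longrightarrow> near_integers \<omega> p m"
  by (simp add: uncontrolled_def)

definition history :: "(nat \<Rightarrow> 'a) \<Rightarrow> nat \<Rightarrow> complex \<times> complex \<Rightarrow> (nat \<Rightarrow> int) list" where
  "history \<omega> N p = map (\<lambda>n. code \<omega> p (N - 1 - n)) [0..<N]"

text \<open>A history runs backwards in time: its step \<open>n\<close> reads the code of block \<open>N - 1 - n\<close>, which is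
  determined by the code of block \<open>N - n\<close> unless one of these two blocks is uncontrolled.\<close>

definition branching_steps :: "nat \<Rightarrow> nat set \<Rightarrow> nat set" where
  "branching_steps N Q = {n. n < N \<and> (n = 0 \<or> N - 1 - n \<in> Q \<or> N - n \<in> Q)}"

lemma card_branching_steps_le:
  assumes "finite Q"
  shows "card (branching_steps N Q) \<le> 1 + 2 * card Q"
proof -
  have "branching_steps N Q \<subseteq> {0} \<union> ((\<lambda>m. N - 1 - m) ` Q \<union> (\<lambda>m. N - m) ` Q)" (is "_ \<subseteq> ?R")
  proof
    fix n assume n_in: "n \<in> branching_steps N Q"
    then have "n = N - 1 - (N - 1 - n)" "n = N - (N - n)" by (auto simp: branching_steps_def)
    then show "n \<in> ?R" using n_in unfolding branching_steps_def by blast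
  qed
  then have "card (branching_steps N Q) \<le> card ?R" using assms by (intro card_mono) auto
  also have "\<dots> \<le> card {0::nat} + (card ((\<lambda>m. N - 1 - m) ` Q) + card ((\<lambda>m. N - m) ` Q))"
    by (meson add_left_mono card_Un_le order_trans)
  also have "\<dots> \<le> 1 + (card Q + card Q)" using assms by (intro add_mono card_image_le) auto
  finally show ?thesis by simp
qed

lemma card_next_code_le:
  assumes normalized: "F \<subseteq> normalized \<omega> N"
    and uncontrolled_eq: "\<And>p. p \<in> F \<Longrightarrow> uncontrolled \<omega> N p = Q"
    and n_less: "n < N" and p_in: "p \<in> F"
  defines "G \<equiv> {p'\<in>F. \<forall>i<n. code \<omega> p' (N - 1 - i) = code \<omega> p (N - 1 - i)}"
  shows "finite ((\<lambda>p. code \<omega> p (N - 1 - n)) ` G) \<and> real (card ((\<lambda>p. code \<omega> p (N - 1 - n)) ` G))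
    \<le> (if n \<in> branching_steps N Q then branching b else 1)"
proof (cases "n = 0")
  case True
  have "G \<subseteq> normalized \<omega> (Suc (N - 1))" using normalized n_less by (auto simp: G_def)
  then show ?thesis
    using code_first_bounded[of G \<omega> "N - 1"] True n_less by (simp add: branching_steps_def)
next
  case False
  define m where "m = N - 1 - n"
  have Suc_m: "Suc m = N - 1 - (n - 1)" "Suc m = N - n" "Suc m < N"
    using False n_less by (auto simp: m_def)
  have in_V: "p' \<in> G \<Longrightarrow> fst p' \<in> V" for p'
    using normalized by (auto simp: G_def normalized_def)
  have same: "code \<omega> p' (Suc m) = code \<omega> p (Suc m)" if "p' \<in> G" for p'
  proof -
    have "n - 1 < n" using False by simp
    then show ?thesis using that unfolding Suc_m(1) G_def by blast
  qed
  have p_in_G: "p \<in> G" using p_in by (simp add: G_def)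
  note bounded = code_earlier_bounded[of G, OF in_V same p_in_G, folded m_def]
  show ?thesis
  proof (cases "n \<in> branching_steps N Q")
    case True
    then show ?thesis using bounded by (simp add: m_def)
  next
    case not_branching: False
    then have "m \<notin> Q" "Suc m \<notin> Q" using n_less Suc_m(2) by (auto simp: branching_steps_def m_def)
    then have "near_integers \<omega> p' m" "near_integers \<omega> p' (Suc m)" if "p' \<in> G" for p'
      using near_integers_if_controlled[of _ N \<omega> p'] that uncontrolled_eq Suc_m(3)
      by (auto simp: G_def)
    then have "code \<omega> p' m = code \<omega> p m" if "p' \<in> G" for p'
      using code_earlier_unique[OF in_V[OF that] in_V[OF p_in_G] same[OF that]] that p_in_G by blast
    then have subset: "(\<lambda>p. code \<omega> p (N - 1 - n)) ` G \<subseteq> {code \<omega> p m}"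
      unfolding m_def[symmetric] by blast
    show ?thesis
      using card_mono[OF _ subset] finite_subset[OF subset] not_branching by simp
  qed
qed

lemma card_history_le:
  assumes normalized: "F \<subseteq> normalized \<omega> N"
    and uncontrolled_eq: "\<And>p. p \<in> F \<Longrightarrow> uncontrolled \<omega> N p = Q" and "finite Q"
  shows "finite (history \<omega> N ` F) \<and> real (card (history \<omega> N ` F)) \<le> branching b ^ (1 + 2 * card Q)"
proof -
  let ?w = "\<lambda>n. if n \<in> branching_steps N Q then branching b else 1"
  have "finite (history \<omega> N ` F) \<and> real (card (history \<omega> N ` F)) \<le> (\<Prod>n<N. ?w n)"
    unfolding history_def
    using card_next_code_le[OF normalized uncontrolled_eq] branching_ge_1[of b]
    by (intro card_histories_le) auto
  moreover have "(\<Prod>n<N. ?w n) = branching b ^ card (branching_steps N Q)"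
  proof -
    have "{n\<in>{..<N}. n \<in> branching_steps N Q} = branching_steps N Q"
      by (auto simp: branching_steps_def)
    then show ?thesis by (subst prod.inter_filter[symmetric]) auto
  qed
  ultimately show ?thesis
    using power_increasing[OF card_branching_steps_le[OF \<open>finite Q\<close>] branching_ge_1[of b], of N]
    by auto
qed

lemma dist_le_if_history_eq:
  assumes N_ge_1: "1 \<le> N" and normalized: "p \<in> normalized \<omega> N" "p' \<in> normalized \<omega> N"
    and same: "history \<omega> N p = history \<omega> N p'"
  shows "dist (fst p) (fst p') \<le> stability / c ^ (4 * b) * (c ^ (4 * b)) ^ N"
proof -
  have in_V: "fst p \<in> V" "fst p' \<in> V" and freq: "1 \<le> cmod (freq \<omega> p' (4 * b * N))"
    using normalized by (auto simp: normalized_def)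
  let ?u = "cmod (freq \<omega> p' (start \<omega> 0))"
  have "history \<omega> N p ! (N - 1) = history \<omega> N p' ! (N - 1)" using same by simp
  then have "code \<omega> p 0 = code \<omega> p' 0" using N_ge_1 by (simp add: history_def)
  from observation_near_if_code_eq[OF this]
  have stable: "cmod (fst p - fst p') * ?u \<le> stability"
    using exponent_and_amplitude_stable(1)[OF in_V,
      of "freq \<omega> p (start \<omega> 0)" "freq \<omega> p' (start \<omega> 0)" 1]
    unfolding observation_def by simp
  have start: "start \<omega> 0 \<le> 4 * b" "4 * b \<le> 4 * b * N"
    using quadruple_start_bounds[OF b_ge_1, of 0 i0 \<omega>] N_ge_1 by auto
  have "c ^ (4 * b) * 1 \<le> c ^ start \<omega> 0 * (?u * c ^ (4 * b * N - start \<omega> 0))"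
    using freq norm_freq_later_le[OF in_V(2), of "start \<omega> 0" "4 * b * N" \<omega>] start c_bounds
    by (intro mult_mono power_decreasing) auto
  also have "\<dots> = ?u * (c ^ start \<omega> 0 * c ^ (4 * b * N - start \<omega> 0))" by (simp only: mult_ac)
  also have "\<dots> = ?u * c ^ (4 * b * N)" using start by (simp add: order_trans flip: power_add)
  finally have "cmod (fst p - fst p') * c ^ (4 * b)
      \<le> cmod (fst p - fst p') * (?u * c ^ (4 * b * N))"
    by (intro mult_left_mono) auto
  also have "\<dots> \<le> stability * c ^ (4 * b * N)"
    using mult_right_mono[OF stable, of "c ^ (4 * b * N)"] c_bounds by (simp add: mult.assoc)
  finally show ?thesis using c_bounds by (simp add: dist_norm pos_le_divide_eq power_mult)
qed

definition exceptional_pairs :: "(nat \<Rightarrow> 'a) \<Rightarrow> nat \<Rightarrow> (complex \<times> complex) set" where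
  "exceptional_pairs \<omega> N =
     {p \<in> normalized \<omega> N. real (card {m. m < N \<and> good \<omega> m \<and> \<not> near_integers \<omega> p m}) \<le> \<kappa> * N}"

definition exceptional :: "(nat \<Rightarrow> 'a) \<Rightarrow> nat \<Rightarrow> complex set" where
  "exceptional \<omega> N = closure ((\<lambda>p. exp (fst p)) ` exceptional_pairs \<omega> N)"

lemma card_uncontrolled_le:
  assumes few_bad: "real (card {m. m < N \<and> \<not> good \<omega> m}) \<le> \<kappa> * N"
    and p_exceptional: "p \<in> exceptional_pairs \<omega> N"
  shows "real (card (uncontrolled \<omega> N p)) \<le> 2 * \<kappa> * N"
proof -
  have "uncontrolled \<omega> N p
      = {m. m < N \<and> \<not> good \<omega> m} \<union> {m. m < N \<and> good \<omega> m \<and> \<not> near_integers \<omega> p m}"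
    by (auto simp: uncontrolled_def)
  then have "card (uncontrolled \<omega> N p)
      \<le> card {m. m < N \<and> \<not> good \<omega> m} + card {m. m < N \<and> good \<omega> m \<and> \<not> near_integers \<omega> p m}"
    by (simp only: card_Un_le)
  then show ?thesis using few_bad p_exceptional by (simp add: exceptional_pairs_def)
qed

lemma card_labels_le:
  assumes few_bad: "real (card {m. m < N \<and> \<not> good \<omega> m}) \<le> \<kappa> * N"
  defines "label \<equiv> \<lambda>p. (uncontrolled \<omega> N p, history \<omega> N p)"
  shows "finite (label ` exceptional_pairs \<omega> N)"
    and "real (card (label ` exceptional_pairs \<omega> N)) \<le> 2 ^ N * branching b powr (1 + 4 * \<kappa> * N)"
proof -
  let ?P = "exceptional_pairs \<omega> N" and ?w = "branching b powr (1 + 4 * \<kappa> * N)"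
  have subset: "uncontrolled \<omega> N ` ?P \<subseteq> Pow {..<N}" by (auto simp: uncontrolled_def)
  then have finite: "finite (uncontrolled \<omega> N ` ?P)" by (rule finite_subset) simp
  have history: "finite (history \<omega> N ` {p'\<in>?P. uncontrolled \<omega> N p' = uncontrolled \<omega> N p})"
    "real (card (history \<omega> N ` {p'\<in>?P. uncontrolled \<omega> N p' = uncontrolled \<omega> N p})) \<le> ?w"
      if p_exceptional: "p \<in> ?P" for p
  proof -
    let ?F = "{p'\<in>?P. uncontrolled \<omega> N p' = uncontrolled \<omega> N p}"
    have count: "finite (history \<omega> N ` ?F)"
      "real (card (history \<omega> N ` ?F)) \<le> branching b ^ (1 + 2 * card (uncontrolled \<omega> N p))"
      using card_history_le[of ?F \<omega> N "uncontrolled \<omega> N p"]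
      by (auto simp: exceptional_pairs_def uncontrolled_def)
    show "finite (history \<omega> N ` ?F)" by (rule count)
    note count(2)
    also have "branching b ^ (1 + 2 * card (uncontrolled \<omega> N p))
        = branching b powr (1 + 2 * card (uncontrolled \<omega> N p))"
      using branching_ge_1[of b] powr_realpow[of "branching b" "1 + 2 * card (uncontrolled \<omega> N p)"]
      by simp
    also have "\<dots> \<le> ?w"
      using branching_ge_1[of b] card_uncontrolled_le[OF few_bad p_exceptional]
      by (intro powr_mono) auto
    finally show "real (card (history \<omega> N ` ?F)) \<le> ?w" .
  qed
  note labels = card_image_Pair_le[OF finite history, folded label_def]
  show "finite (label ` ?P)" by (rule labels(1))
  have "card (uncontrolled \<omega> N ` ?P) \<le> 2 ^ N"
    using card_mono[OF _ subset] by (simp add: card_Pow)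
  then have "real (card (uncontrolled \<omega> N ` ?P)) \<le> 2 ^ N"
    by (simp add: numeral_power_le_of_nat_cancel_iff of_nat_le_numeral_power_cancel_iff)
  then have "real (card (uncontrolled \<omega> N ` ?P)) * ?w \<le> 2 ^ N * ?w" by (rule mult_right_mono) simp
  with labels(2) show "real (card (label ` ?P)) \<le> 2 ^ N * ?w" by linarith
qed

lemma exceptional_cong:
  assumes agree: "\<And>j. j < 4 * b * N \<Longrightarrow> \<omega> j = \<omega>' j"
  shows "exceptional \<omega> N = exceptional \<omega>' N"
proof -
  have freq: "freq \<omega> p n = freq \<omega>' p n" if "n \<le> 4 * b * N" for p n
    using agree that by (intro freq_cong) auto
  have block: "4 * b * Suc m \<le> 4 * b * N" if "m < N" for m
    using that by (intro mult_le_mono2) simp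
  have good: "good \<omega> m = good \<omega>' m" if "m < N" for m
    using block[OF that] agree by (intro good_block_cong) auto
  have start: "start \<omega> m = start \<omega>' m" if "m < N" for m
    using block[OF that] agree by (intro quadruple_start_cong) auto
  have "observation \<omega> p m = observation \<omega>' p m" if "m < N" for p m
  proof -
    have "start \<omega>' m \<le> 4 * b * N"
      using quadruple_start_bounds[OF b_ge_1, of m i0 \<omega>'] block[OF that] by linarith
    then show ?thesis unfolding observation_def start[OF that] using freq by presburger
  qed
  then have "near_integers \<omega> p m = near_integers \<omega>' p m" if "m < N" for p m
    using that by (simp add: near_integers_def)
  then have "{m. m < N \<and> good \<omega> m \<and> \<not> near_integers \<omega> p m}
      = {m. m < N \<and> good \<omega>' m \<and> \<not> near_integers \<omega>' p m}" for p
    using good by blast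
  then have "exceptional_pairs \<omega> N = exceptional_pairs \<omega>' N"
    unfolding exceptional_pairs_def normalized_def using freq by simp
  then show ?thesis by (simp add: exceptional_def)
qed

lemma exceptional_content_le:
  assumes s_ge_1: "1 \<le> s" and N_ge_1: "1 \<le> N"
    and few_bad: "real (card {m. m < N \<and> \<not> good \<omega> m}) \<le> \<kappa> * N"
    and small: "stability / c ^ (4 * b) * (c ^ (4 * b)) ^ N \<le> 1"
  shows "hausdorff_content s (exceptional \<omega> N)
      \<le> ennreal (branching b * stability / c ^ (4 * b) * (1/2) ^ N)"
proof -
  let ?label = "\<lambda>p. (uncontrolled \<omega> N p, history \<omega> N p)"
  let ?r = "stability / c ^ (4 * b) * (c ^ (4 * b)) ^ N"
  have r_nonneg: "0 \<le> ?r" using stability_ge_1 c_bounds by simp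
  have "hausdorff_content s (exceptional \<omega> N)
      \<le> ennreal (card (?label ` exceptional_pairs \<omega> N) * ?r powr s)"
    unfolding exceptional_def
  proof (rule hausdorff_content_closure_image_le[OF card_labels_le(1)[OF few_bad] r_nonneg])
    fix p p'
    assume same_label: "p \<in> exceptional_pairs \<omega> N" "p' \<in> exceptional_pairs \<omega> N"
      "?label p = ?label p'"
    then have normalized: "p \<in> normalized \<omega> N" "p' \<in> normalized \<omega> N"
      by (auto simp: exceptional_pairs_def)
    then have "dist (exp (fst p)) (exp (fst p')) \<le> dist (fst p) (fst p')"
      using Re_neg by (intro dist_exp_le_dist) (auto simp: normalized_def less_imp_le)
    also have "\<dots> \<le> ?r"
      using same_label(3) by (intro dist_le_if_history_eq[OF N_ge_1 normalized]) simp
    finally show "dist (exp (fst p)) (exp (fst p')) \<le> ?r" .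
  qed (use s_ge_1 in simp)
  also have "\<dots> \<le> ennreal (branching b * stability / c ^ (4 * b) * (1/2) ^ N)"
  proof (rule ennreal_leI)
    have "?r powr s \<le> ?r" using powr_mono'[OF s_ge_1 r_nonneg small] r_nonneg by simp
    then have "card (?label ` exceptional_pairs \<omega> N) * ?r powr s
        \<le> (2 ^ N * branching b powr (1 + 4 * \<kappa> * N)) * ?r"
      using card_labels_le(2)[OF few_bad] by (intro mult_mono) auto
    also have "branching b powr (1 + 4 * \<kappa> * N) = branching b * (branching b powr (4 * \<kappa>)) ^ N"
      using branching_ge_1[of b] by (simp add: powr_add powr_realpow[symmetric] powr_powr)
    also have "(2 ^ N * (branching b * (branching b powr (4 * \<kappa>)) ^ N)) * ?r
        = branching b * stability / c ^ (4 * b) * (2 * branching b powr (4 * \<kappa>) * c ^ (4 * b)) ^ N"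
      by (simp add: power_mult_distrib)
    also have "\<dots> \<le> branching b * stability / c ^ (4 * b) * (1/2) ^ N"
      using rate c_bounds branching_ge_1[of b] stability_ge_1
      by (intro mult_left_mono power_mono) auto
    finally show "card (?label ` exceptional_pairs \<omega> N) * ?r powr s
        \<le> branching b * stability / c ^ (4 * b) * (1/2) ^ N" .
  qed
  finally show ?thesis .
qed

lemma limsup_exceptional_content_eq_0:
  assumes s_ge_1: "1 \<le> s"
    and few_bad: "\<forall>\<^sub>F N in sequentially. real (card {m. m < N \<and> \<not> good \<omega> m}) \<le> \<kappa> * N"
  shows "hausdorff_content s (limsup (exceptional \<omega>)) = 0"
proof (rule hausdorff_content_limsup_eq_0)
  let ?Z = "branching b * stability / c ^ (4 * b)"
  show "summable (\<lambda>N. ?Z * (1/2) ^ N)" by (intro summable_mult summable_geometric) simp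
  show "0 \<le> ?Z * (1/2) ^ N" for N
    using branching_ge_1[of b] stability_ge_1 c_bounds by simp
  have "c ^ (4 * b) < 1" using c_bounds b_ge_1 by (simp add: power_less_one_iff)
  then have "(\<lambda>N. stability / c ^ (4 * b) * (c ^ (4 * b)) ^ N) \<longlonglongrightarrow> stability / c ^ (4 * b) * 0"
    using c_bounds by (intro tendsto_intros LIMSEQ_power_zero) simp
  then have "\<forall>\<^sub>F N in sequentially. stability / c ^ (4 * b) * (c ^ (4 * b)) ^ N < 1"
    by (rule order_tendstoD) simp
  then show "\<forall>\<^sub>F N in sequentially. hausdorff_content s (exceptional \<omega> N)
      \<le> ennreal (?Z * (1/2) ^ N)"
    using few_bad eventually_ge_at_top[of 1]
    by eventually_elim (rule exceptional_content_le[OF s_ge_1], simp_all)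
qed

lemma freq_start_add:
  assumes "good \<omega> m" "j < 4"
  shows "freq \<omega> p (start \<omega> m + j) = freq \<omega> p (start \<omega> m) * exp (\<beta> i0 * fst p) ^ j"
proof -
  have "(\<Sum>i\<in>{start \<omega> m..<start \<omega> m + j}. \<beta> (\<omega> i)) = (\<Sum>i<j. \<beta> (\<omega> (start \<omega> m + i)))"
    by (simp add: sum.shift_bounds_nat_ivl[of _ 0 "start \<omega> m" j, simplified]
        lessThan_atLeast0 add.commute)
  also have "\<dots> = (\<Sum>i<j. \<beta> i0)"
    using letter_at_quadruple_start[OF assms(1)] assms(2) by (intro sum.cong) auto
  finally show ?thesis
    by (simp add: freq_later[of "start \<omega> m" "start \<omega> m + j"] exp_of_nat_mult[symmetric] mult_ac)
qed

lemma fourier_factor_gap: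
  assumes model: "planar_model k t p (\<lambda>i. exp (\<beta> i * s))"
    and digits: "j1 < k i0" "j2 < k i0" "t i0 j1 \<noteq> t i0 j2"
  obtains \<gamma> where "0 < \<gamma>" "\<gamma> < 1"
    "\<And>\<omega> \<xi> m. good \<omega> m \<Longrightarrow> \<not> near_integers \<omega> (s, (t i0 j1 - t i0 j2) * cnj \<xi>) m \<Longrightarrow>
      \<exists>n\<in>{m * (4 * b)..<m * (4 * b) + 4 * b}.
        cmod (fourier_factor k t p (\<lambda>i. exp (\<beta> i * s)) \<omega> \<xi> n) \<le> \<gamma>"
proof -
  have weights: "\<And>j. j < k i0 \<Longrightarrow> 0 < p i0 j" "(\<Sum>j<k i0. p i0 j) = 1"
    using model by (auto simp: planar_model_def)
  have "j1 \<noteq> j2" using digits(3) by auto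
  then obtain \<gamma> where \<gamma>_bounds: "0 < \<gamma>" "\<gamma> < 1" and gap: "\<And>y. tolerance \<le> dist_Ints (y j1 - y j2) \<Longrightarrow>
      cmod (\<Sum>j<k i0. p i0 j * cis (2 * pi * y j)) \<le> \<gamma>"
    using digit_sum_gap[OF weights digits(1,2) _ tolerance_pos tolerance_le_half] by blast
  show thesis
  proof (rule that[OF \<gamma>_bounds])
    fix \<omega> \<xi> m
    let ?q = "(s, (t i0 j1 - t i0 j2) * cnj \<xi>)"
    assume good: "good \<omega> m" and "\<not> near_integers \<omega> ?q m"
    then obtain j where far: "j < 4" "tolerance \<le> dist_Ints (observation \<omega> ?q m j)"
      unfolding near_integers_def by force
    let ?n = "start \<omega> m + j"
    let ?\<Lambda> = "\<Prod>i<?n. exp (\<beta> (\<omega> i) * s)"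
    have "observation \<omega> ?q m j = Re (freq \<omega> ?q ?n)"
      unfolding observation_def freq_start_add[OF good far(1)] ..
    also have "\<dots> = Re (?\<Lambda> * t i0 j1 * cnj \<xi>) - Re (?\<Lambda> * t i0 j2 * cnj \<xi>)"
      unfolding freq_eq_prod by (simp add: algebra_simps)
    finally have "cmod (fourier_factor k t p (\<lambda>i. exp (\<beta> i * s)) \<omega> \<xi> ?n) \<le> \<gamma>"
      using far(2) unfolding fourier_factor_def letter_at_quadruple_start[OF good far(1)]
      by (intro gap) simp
    moreover have "?n \<in> {m * (4 * b)..<m * (4 * b) + 4 * b}"
      using quadruple_start_bounds[OF b_ge_1, of m i0 \<omega>] far(1) by (auto simp: algebra_simps)
    ultimately show "\<exists>n\<in>{m * (4 * b)..<m * (4 * b) + 4 * b}.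
        cmod (fourier_factor k t p (\<lambda>i. exp (\<beta> i * s)) \<omega> \<xi> n) \<le> \<gamma>" by blast
  qed
qed

lemma exists_normalized:
  assumes s_in_V: "s \<in> V" and \<zeta>_ge_1: "1 \<le> cmod \<zeta>"
  obtains N where "(s, \<zeta>) \<in> normalized \<omega> N" "cmod \<zeta> \<le> (L ^ (4 * b)) ^ Suc N"
proof -
  let ?f = "\<lambda>N. cmod (freq \<omega> (s, \<zeta>) (4 * b * N))"
  have later: "?f N \<le> cmod \<zeta> * c ^ (4 * b * N)" for N
    using norm_freq_later_le[of "(s, \<zeta>)" 0 "4 * b * N" \<omega>] s_in_V by simp
  have earlier: "?f N \<le> ?f N' * (L ^ (4 * b)) ^ (N' - N)" if "N \<le> N'" for N N'
    using norm_freq_earlier_le[of "(s, \<zeta>)" "4 * b * N" "4 * b * N'" \<omega>] s_in_V that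
    by (simp add: right_diff_distrib' flip: power_mult)
  have "(\<lambda>N. cmod \<zeta> * (c ^ (4 * b)) ^ N) \<longlonglongrightarrow> cmod \<zeta> * 0"
    using c_bounds b_ge_1 by (intro tendsto_intros LIMSEQ_power_zero) (simp add: power_less_one_iff)
  then have "\<forall>\<^sub>F N in sequentially. cmod \<zeta> * (c ^ (4 * b)) ^ N < 1" by (rule order_tendstoD) simp
  then obtain N0 where "cmod \<zeta> * (c ^ (4 * b)) ^ N0 < 1" unfolding eventually_sequentially by blast
  then have "?f N0 < 1" using later[of N0] by (simp add: power_mult)
  define N' where "N' = (LEAST N. ?f N < 1)"
  have below_1: "?f N' < 1" unfolding N'_def using \<open>?f N0 < 1\<close> by (rule LeastI)
  moreover have "\<not> ?f 0 < 1" using \<zeta>_ge_1 by simp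
  ultimately obtain N where N'_eq_Suc: "N' = Suc N" by (cases N') auto
  have large: "1 \<le> ?f N"
    using not_less_Least[of N "\<lambda>N. ?f N < 1"] N'_eq_Suc unfolding N'_def by force
  have "?f N \<le> ?f N' * (L ^ (4 * b)) ^ 1" using earlier[of N N'] N'_eq_Suc by simp
  also have "\<dots> \<le> 1 * L ^ (4 * b)" using below_1 L_gt_1 by (intro mult_mono) auto
  finally have bounded: "?f N \<le> L ^ (4 * b)" by simp
  have "cmod \<zeta> \<le> ?f N' * (L ^ (4 * b)) ^ N'" using earlier[of 0 N'] by simp
  also have "\<dots> \<le> 1 * (L ^ (4 * b)) ^ Suc N"
    unfolding N'_eq_Suc using below_1 L_gt_1 N'_eq_Suc by (intro mult_right_mono) auto
  finally have "cmod \<zeta> \<le> (L ^ (4 * b)) ^ Suc N" by simp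
  moreover have "(s, \<zeta>) \<in> normalized \<omega> N" using s_in_V large bounded by (simp add: normalized_def)
  ultimately show thesis by (rule that[rotated])
qed

lemma fourier_transform_le_if_not_exceptional:
  assumes model: "planar_model k t p (\<lambda>i. exp (\<beta> i * s))" and \<gamma>_bounds: "0 < \<gamma>" "\<gamma> < 1"
    and gap: "\<And>m. good \<omega> m \<Longrightarrow> \<not> near_integers \<omega> q m \<Longrightarrow>
      \<exists>n\<in>{m * (4 * b)..<m * (4 * b) + 4 * b}.
        cmod (fourier_factor k t p (\<lambda>i. exp (\<beta> i * s)) \<omega> \<xi> n) \<le> \<gamma>"
    and normalized_not_exceptional: "q \<in> normalized \<omega> N" "q \<notin> exceptional_pairs \<omega> N"
  shows "cmod (fourier_transform (eta k t p (\<lambda>i. exp (\<beta> i * s)) \<omega>) \<xi>) \<le> (\<gamma> powr \<kappa>) ^ N"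
proof -
  let ?A = "{m. m < N \<and> good \<omega> m \<and> \<not> near_integers \<omega> q m}"
  let ?\<phi> = "\<lambda>n. cmod (fourier_factor k t p (\<lambda>i. exp (\<beta> i * s)) \<omega> \<xi> n)"
  have "cmod (fourier_transform (eta k t p (\<lambda>i. exp (\<beta> i * s)) \<omega>) \<xi>) \<le> (\<Prod>n<N * (4 * b). ?\<phi> n)"
    by (rule norm_fourier_transform_eta_le[OF model])
  also have "\<dots> \<le> \<gamma> ^ card ?A"
    using norm_fourier_factor_le_1[OF model] gap \<gamma>_bounds by (intro prod_le_power_card_blocks) auto
  also have "\<dots> = \<gamma> powr card ?A" using \<gamma>_bounds(1) by (simp add: powr_realpow)
  also have "\<dots> \<le> \<gamma> powr (\<kappa> * N)"
    using normalized_not_exceptional \<gamma>_bounds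
    by (intro powr_mono') (auto simp: exceptional_pairs_def)
  also have "\<dots> = (\<gamma> powr \<kappa>) ^ N" using \<gamma>_bounds(1) by (simp add: powr_realpow[symmetric] powr_powr)
  finally show ?thesis .
qed

lemma fourier_transform_decay:
  assumes s_in_V: "s \<in> V" and not_exceptional: "\<And>N. N0 \<le> N \<Longrightarrow> exp s \<notin> exceptional \<omega> N"
    and model: "planar_model k t p (\<lambda>i. exp (\<beta> i * s))" and \<gamma>_bounds: "0 < \<gamma>" "\<gamma> < 1"
    and gap: "\<And>m. good \<omega> m \<Longrightarrow> \<not> near_integers \<omega> (s, \<zeta>) m \<Longrightarrow>
      \<exists>n\<in>{m * (4 * b)..<m * (4 * b) + 4 * b}.
        cmod (fourier_factor k t p (\<lambda>i. exp (\<beta> i * s)) \<omega> \<xi> n) \<le> \<gamma>"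
    and \<zeta>_ge_1: "1 \<le> cmod \<zeta>"
  obtains N where "cmod \<zeta> \<le> (L ^ (4 * b)) ^ Suc N"
    "cmod (fourier_transform (eta k t p (\<lambda>i. exp (\<beta> i * s)) \<omega>) \<xi>)
        \<le> (\<gamma> powr \<kappa>) ^ N / (\<gamma> powr \<kappa>) ^ N0"
proof -
  let ?FT = "fourier_transform (eta k t p (\<lambda>i. exp (\<beta> i * s)) \<omega>) \<xi>" and ?\<theta> = "\<gamma> powr \<kappa>"
  have \<theta>_bounds: "0 < ?\<theta>" "?\<theta> < 1" using \<gamma>_bounds \<kappa>_pos by (simp_all add: powr01_less_one)
  obtain N where scale: "(s, \<zeta>) \<in> normalized \<omega> N" "cmod \<zeta> \<le> (L ^ (4 * b)) ^ Suc N"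
    using exists_normalized[OF s_in_V \<zeta>_ge_1] by blast
  have "cmod ?FT \<le> ?\<theta> ^ N / ?\<theta> ^ N0"
  proof (cases "N0 \<le> N")
    case True
    have "(s, \<zeta>) \<notin> exceptional_pairs \<omega> N"
      using not_exceptional[OF True] closure_subset[of "(\<lambda>p. exp (fst p)) ` exceptional_pairs \<omega> N"]
      unfolding exceptional_def by force
    then have "cmod ?FT \<le> ?\<theta> ^ N"
      using fourier_transform_le_if_not_exceptional[OF model \<gamma>_bounds gap scale(1)] by blast
    also have "\<dots> \<le> ?\<theta> ^ N / ?\<theta> ^ N0"
      using \<theta>_bounds by (simp add: le_divide_eq power_le_one mult_left_le)
    finally show ?thesis .
  next
    case False
    have "cmod ?FT \<le> 1" using norm_fourier_transform_eta_le[OF model, of \<omega> \<xi> 0] by simp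
    also have "1 \<le> ?\<theta> ^ N / ?\<theta> ^ N0"
      using \<theta>_bounds False by (simp add: le_divide_eq power_decreasing)
    finally show ?thesis .
  qed
  with scale(2) show thesis by (rule that)
qed

lemma eta_in_D2:
  assumes s_in_V: "s \<in> V" and not_exceptional: "exp s \<notin> limsup (exceptional \<omega>)"
    and model: "planar_model k t p (\<lambda>i. exp (\<beta> i * s))"
    and digits: "j1 < k i0" "j2 < k i0" "t i0 j1 \<noteq> t i0 j2"
  shows "eta k t p (\<lambda>i. exp (\<beta> i * s)) \<omega> \<in> D2"
proof -
  let ?a = "t i0 j1 - t i0 j2" and ?FT = "fourier_transform (eta k t p (\<lambda>i. exp (\<beta> i * s)) \<omega>)"
  obtain \<gamma> where \<gamma>_bounds: "0 < \<gamma>" "\<gamma> < 1"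
    and gap: "\<And>\<xi> m. good \<omega> m \<Longrightarrow> \<not> near_integers \<omega> (s, ?a * cnj \<xi>) m \<Longrightarrow>
      \<exists>n\<in>{m * (4 * b)..<m * (4 * b) + 4 * b}.
        cmod (fourier_factor k t p (\<lambda>i. exp (\<beta> i * s)) \<omega> \<xi> n) \<le> \<gamma>"
    using fourier_factor_gap[OF model digits] by metis
  define \<theta> where "\<theta> = \<gamma> powr \<kappa>"
  have \<theta>_bounds: "0 < \<theta>" "\<theta> < 1"
    unfolding \<theta>_def using \<gamma>_bounds \<kappa>_pos by (simp_all add: powr01_less_one)
  obtain N0 where eventually_not_exceptional: "\<And>N. N0 \<le> N \<Longrightarrow> exp s \<notin> exceptional \<omega> N"
    using not_exceptional unfolding limsup_INF_SUP by auto
  show ?thesis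
  proof (rule D2_geometric_scales[of "L ^ (4 * b)" \<theta> "cmod ?a" "1 / \<theta> ^ Suc N0"])
    fix \<xi> :: complex
    show "\<exists>N. cmod ?a * cmod \<xi> \<le> (L ^ (4 * b)) ^ N \<and> cmod (?FT \<xi>) \<le> 1 / \<theta> ^ Suc N0 * \<theta> ^ N"
    proof (cases "1 \<le> cmod (?a * cnj \<xi>)")
      case True
      then obtain N
        where "cmod (?a * cnj \<xi>) \<le> (L ^ (4 * b)) ^ Suc N" "cmod (?FT \<xi>) \<le> \<theta> ^ N / \<theta> ^ N0"
        using fourier_transform_decay[OF s_in_V eventually_not_exceptional model \<gamma>_bounds gap]
        unfolding \<theta>_def by blast
      then show ?thesis using \<theta>_bounds by (auto simp: norm_mult intro!: exI[of _ "Suc N"])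
    next
      case False
      then have "cmod ?a * cmod \<xi> \<le> (L ^ (4 * b)) ^ 1"
        using one_le_power[of L "4 * b"] L_gt_1 unfolding norm_mult complex_mod_cnj power_one_right
        by linarith
      moreover have "cmod (?FT \<xi>) \<le> 1 / \<theta> ^ Suc N0 * \<theta> ^ 1"
      proof -
        have "cmod (?FT \<xi>) \<le> 1" using norm_fourier_transform_eta_le[OF model, of \<omega> \<xi> 0] by simp
        also have "1 \<le> 1 / \<theta> ^ Suc N0 * \<theta> ^ 1"
          using \<theta>_bounds by (simp add: le_divide_eq power_le_one)
        finally show ?thesis .
      qed
      ultimately show ?thesis by blast
    qed
  qed (use \<theta>_bounds digits L_gt_1 b_ge_1 in \<open>auto intro: one_less_power\<close>)
qed

end

section \<open>Few bad blocks\<close>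

lemma power_powr_commute: "0 \<le> x \<Longrightarrow> n \<noteq> 0 \<Longrightarrow> (x ^ n) powr a = (x powr a) ^ n" for x a :: real
  by (cases "x = 0") (simp_all add: zero_power powr_realpow[symmetric] powr_powr mult.commute)

context prob_space
begin

context
  fixes B :: "nat \<Rightarrow> 'a set" and x \<kappa> :: real
  assumes events: "\<And>m. B m \<in> events"
    and prob_INT_le: "\<And>Q. finite Q \<Longrightarrow> Q \<noteq> {} \<Longrightarrow> prob (\<Inter>m\<in>Q. B m) \<le> x ^ card Q"
    and x_bounds: "0 \<le> x" "x \<le> 1" and \<kappa>_pos: "0 < \<kappa>"
begin

lemma prob_INT_le_powr:
  assumes Q_large: "finite Q" "\<kappa> * real N < card Q"
  shows "prob (\<Inter>m\<in>Q. B m) \<le> (x powr \<kappa>) ^ N"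
proof -
  have "0 \<le> \<kappa> * N" using \<kappa>_pos by simp
  then have card_pos: "0 < card Q" using Q_large(2) by (metis of_nat_0_less_iff order_le_less_trans)
  then have INT_le: "prob (\<Inter>m\<in>Q. B m) \<le> x ^ card Q" using Q_large(1) by (intro prob_INT_le) auto
  show ?thesis
  proof (cases "x = 0")
    case True
    then have "prob (\<Inter>m\<in>Q. B m) \<le> 0" using INT_le card_pos by (simp add: zero_power)
    then show ?thesis by (rule order_trans) simp
  next
    case False
    have "x ^ card Q = x powr card Q" using False x_bounds by (simp add: powr_realpow)
    also have "\<dots> \<le> x powr (\<kappa> * N)" using x_bounds False Q_large(2) by (intro powr_mono') auto
    also have "\<dots> = (x powr \<kappa>) ^ N"
      using x_bounds False by (simp add: powr_realpow[symmetric] powr_powr)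
    finally show ?thesis using INT_le by linarith
  qed
qed

lemma prob_many_events_le:
  defines "many \<equiv> \<lambda>N. {\<omega> \<in> space M. \<kappa> * real N < card {m. m < N \<and> \<omega> \<in> B m}}"
  shows "many N \<in> events" and "prob (many N) \<le> (2 * x powr \<kappa>) ^ N"
proof -
  let ?\<Q> = "{Q. Q \<subseteq> {..<N} \<and> \<kappa> * real N < card Q}"
  have "?\<Q> \<subseteq> Pow {..<N}" by auto
  then have finite_\<Q>: "finite ?\<Q>" and "card ?\<Q> \<le> card (Pow {..<N})"
    by (auto intro: finite_subset card_mono)
  then have card_\<Q>: "real (card ?\<Q>) \<le> 2 ^ N"
    by (simp add: card_Pow of_nat_le_numeral_power_cancel_iff)
  have finite: "finite Q" "Q \<noteq> {}" if "Q \<in> ?\<Q>" for Q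
    using that \<kappa>_pos finite_subset by (auto simp: mult_less_0_iff)
  have INT_events: "(\<Inter>m\<in>Q. B m) \<in> events" if "Q \<in> ?\<Q>" for Q
    using events finite[OF that] by (intro sets.finite_INT) auto
  have INT_le: "prob (\<Inter>m\<in>Q. B m) \<le> (x powr \<kappa>) ^ N" if "Q \<in> ?\<Q>" for Q
    using prob_INT_le_powr[OF finite(1)[OF that]] that by simp
  have many_eq: "many N = (\<Union>Q\<in>?\<Q>. \<Inter>m\<in>Q. B m)"
  proof (intro set_eqI iffI)
    fix \<omega> assume "\<omega> \<in> many N"
    then have "{m. m < N \<and> \<omega> \<in> B m} \<in> ?\<Q>" by (auto simp: many_def)
    then show "\<omega> \<in> (\<Union>Q\<in>?\<Q>. \<Inter>m\<in>Q. B m)" by (rule UN_I) simp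
  next
    fix \<omega> assume "\<omega> \<in> (\<Union>Q\<in>?\<Q>. \<Inter>m\<in>Q. B m)"
    then obtain Q where Q_in: "Q \<in> ?\<Q>" "\<omega> \<in> (\<Inter>m\<in>Q. B m)" by blast
    then have "card Q \<le> card {m. m < N \<and> \<omega> \<in> B m}" by (intro card_mono) auto
    moreover have "\<omega> \<in> space M"
      using sets.sets_into_space[OF INT_events[OF Q_in(1)]] Q_in(2) by blast
    ultimately show "\<omega> \<in> many N" using Q_in(1) by (auto simp: many_def)
  qed
  show "many N \<in> events" unfolding many_eq using finite_\<Q> INT_events by (intro sets.finite_UN) auto
  have "prob (many N) \<le> (\<Sum>Q\<in>?\<Q>. prob (\<Inter>m\<in>Q. B m))"
    unfolding many_eq using INT_events by (intro finite_measure_subadditive_finite finite_\<Q>) auto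
  also have "\<dots> \<le> card ?\<Q> * (x powr \<kappa>) ^ N"
    by (rule sum_bounded_above[OF INT_le])
  also have "\<dots> \<le> 2 ^ N * (x powr \<kappa>) ^ N" using card_\<Q> by (intro mult_right_mono) auto
  finally show "prob (many N) \<le> (2 * x powr \<kappa>) ^ N" by (simp add: power_mult_distrib)
qed

lemma AE_eventually_few_events:
  assumes rate: "2 * x powr \<kappa> < 1"
  shows "AE \<omega> in M. \<forall>\<^sub>F N in sequentially. real (card {m. m < N \<and> \<omega> \<in> B m}) \<le> \<kappa> * N"
proof -
  let ?many = "\<lambda>N. {\<omega> \<in> space M. \<kappa> * real N < card {m. m < N \<and> \<omega> \<in> B m}}"
  have "summable (\<lambda>N. (2 * x powr \<kappa>) ^ N)" using rate by (intro summable_geometric) simp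
  then have "summable (\<lambda>N. prob (?many N))"
    by (rule summable_comparison_test'[where N = 0]) (use prob_many_events_le(2) in simp)
  then have "AE \<omega> in M. \<forall>\<^sub>F N in sequentially. \<omega> \<in> space M - ?many N"
  proof (intro borel_cantelli_AE1)
    show "?many N \<in> events" for N by (rule prob_many_events_le(1))
  qed (simp_all add: emeasure_eq_measure)
  then show ?thesis
  proof eventually_elim
    case (elim \<omega>)
    then show ?case by eventually_elim (simp add: not_less)
  qed
qed

end

end

lemma (in product_prob_space) indep_vars_coordinates:
  assumes "I \<noteq> {}"
  shows "indep_vars M (\<lambda>i x. x i) I"
proof (subst indep_vars_iff_distr_eq_PiM'[OF assms])
  have "distr (PiM I M) (PiM I M) (\<lambda>x. \<lambda>i\<in>I. x i) = distr (PiM I M) (PiM I M) (\<lambda>x. x)"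
    by (intro distr_cong) (auto simp: space_PiM PiE_def extensional_restrict)
  also have "\<dots> = PiM I (\<lambda>i. distr (PiM I M) (M i) (\<lambda>x. x i))"
    by (simp add: distr_id) (intro PiM_cong, auto simp: PiM_component)
  finally show "distr (PiM I M) (PiM I M) (\<lambda>x. \<lambda>i\<in>I. x i)
      = PiM I (\<lambda>i. distr (PiM I M) (M i) (\<lambda>x. x i))" .
qed auto

lemma space_bernoulli_measure [simp]: "space (bernoulli_measure q) = UNIV"
  by (simp add: bernoulli_measure_def space_PiM)

lemma product_prob_space_bernoulli: "product_prob_space (\<lambda>_. measure_pmf q)"
  by (intro product_prob_spaceI prob_space_measure_pmf)

lemma prob_space_bernoulli_measure: "prob_space (bernoulli_measure q)"
  unfolding bernoulli_measure_def by (intro prob_space_PiM prob_space_measure_pmf)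

lemma constant_quadruple_eq_PiE:
  "{x \<in> space (PiM {4 * k..<4 * k + 4} (\<lambda>_. measure_pmf q)). constant_quadruple i x k}
    = (\<Pi>\<^sub>E n\<in>{4 * k..<4 * k + 4}. {i})"
  by (auto simp: space_PiM constant_quadruple_def PiE_iff extensional_def fun_eq_iff)

lemma indep_constant_quadruples:
  "prob_space.indep_events (bernoulli_measure q) (\<lambda>k. {\<omega>. \<not> constant_quadruple i \<omega> k}) UNIV"
proof -
  interpret P: prob_space "bernoulli_measure q" by (rule prob_space_bernoulli_measure)
  interpret C: product_prob_space "\<lambda>_::nat. measure_pmf q" UNIV
    by (rule product_prob_space_bernoulli)
  let ?K = "\<lambda>k::nat. {4 * k..<4 * k + 4}"
  let ?N = "\<lambda>k. PiM (?K k) (\<lambda>_. measure_pmf q)"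
  have "P.indep_vars (\<lambda>_. measure_pmf q) (\<lambda>n \<omega>. \<omega> n) UNIV"
    unfolding bernoulli_measure_def by (rule C.indep_vars_coordinates) simp
  then have "P.indep_vars ?N (\<lambda>k \<omega>. restrict (\<lambda>n. \<omega> n) (?K k)) UNIV"
    by (rule P.indep_vars_restrict) (auto simp: disjoint_family_on_def)
  then have "P.indep_events (\<lambda>k. {\<omega> \<in> space (bernoulli_measure q).
      \<not> constant_quadruple i (restrict (\<lambda>n. \<omega> n) (?K k)) k}) UNIV"
  proof (rule P.indep_eventsI_indep_vars)
    fix k
    have "{x \<in> space (?N k). constant_quadruple i x k} \<in> sets (?N k)"
      unfolding constant_quadruple_eq_PiE by (intro sets_PiM_I_finite) auto
    then show "{x \<in> space (?N k). \<not> constant_quadruple i x k} \<in> sets (?N k)"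
      by (rule sets.sets_Collect_neg)
  qed
  then show ?thesis by (simp add: constant_quadruple_def)
qed

lemma prob_not_constant_quadruple:
  "measure (bernoulli_measure q) {\<omega>. \<not> constant_quadruple i \<omega> k} = 1 - pmf q i ^ 4"
proof -
  interpret P: prob_space "bernoulli_measure q" by (rule prob_space_bernoulli_measure)
  interpret C: product_prob_space "\<lambda>_::nat. measure_pmf q" UNIV
    by (rule product_prob_space_bernoulli)
  let ?K = "{4 * k..<4 * k + 4}" and ?B = "{\<omega>. \<not> constant_quadruple i \<omega> k}"
  have B_event: "?B \<in> sets (bernoulli_measure q)"
    using indep_constant_quadruples[of q i] unfolding P.indep_events_def by auto
  have "space (bernoulli_measure q) - ?B = {\<omega> \<in> space (bernoulli_measure q). \<forall>n\<in>?K. \<omega> n \<in> {i}}"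
    by (auto simp: constant_quadruple_def)
  also have "emeasure (bernoulli_measure q) \<dots> = (\<Prod>n\<in>?K. emeasure (measure_pmf q) {i})"
    unfolding bernoulli_measure_def by (rule C.emeasure_PiM_Collect) auto
  finally have "P.prob (space (bernoulli_measure q) - ?B) = pmf q i ^ 4"
    by (simp add: measure_def emeasure_pmf_single ennreal_power)
  then show ?thesis using P.prob_compl[OF B_event] by simp
qed

lemma prob_no_constant_quadruple:
  assumes "finite T" "T \<noteq> {}"
  shows "measure (bernoulli_measure q) (\<Inter>k\<in>T. {\<omega>. \<not> constant_quadruple i \<omega> k})
      = (1 - pmf q i ^ 4) ^ card T"
proof -
  interpret P: prob_space "bernoulli_measure q" by (rule prob_space_bernoulli_measure)
  show ?thesis
    using indep_constant_quadruples[of q i] assms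
    unfolding P.indep_events_def by (simp add: prob_not_constant_quadruple)
qed

lemma AE_few_bad_blocks:
  assumes b_ge_1: "1 \<le> b" and \<kappa>_pos: "0 < \<kappa>" and rate: "2 * ((1 - pmf q i ^ 4) ^ b) powr \<kappa> < 1"
  shows "AE \<omega> in bernoulli_measure q. \<forall>\<^sub>F N in sequentially.
     real (card {m. m < N \<and> \<not> good_block i b \<omega> m}) \<le> \<kappa> * N"
proof -
  interpret P: prob_space "bernoulli_measure q" by (rule prob_space_bernoulli_measure)
  let ?D = "\<lambda>k. {\<omega>. \<not> constant_quadruple i \<omega> k}" and ?T = "\<lambda>Q. \<Union>m\<in>Q. {m * b..<Suc m * b}"
  have D_event: "?D k \<in> P.events" for k
    using indep_constant_quadruples[of q i] unfolding P.indep_events_def by auto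
  have bad_eq: "{\<omega>. \<not> good_block i b \<omega> m} = (\<Inter>k\<in>{m * b..<Suc m * b}. ?D k)" for m
    by (auto simp: good_block_def)
  have "AE \<omega> in bernoulli_measure q. \<forall>\<^sub>F N in sequentially.
     real (card {m. m < N \<and> \<omega> \<in> {\<omega>. \<not> good_block i b \<omega> m}}) \<le> \<kappa> * N"
  proof (rule P.AE_eventually_few_events[OF _ _ _ _ \<kappa>_pos rate])
    show "{\<omega>. \<not> good_block i b \<omega> m} \<in> P.events" for m
      unfolding bad_eq using b_ge_1 D_event by (intro sets.finite_INT) auto
    fix Q :: "nat set" assume Q_finite: "finite Q" "Q \<noteq> {}"
    have "disjoint_family_on (\<lambda>m. {m * b..<Suc m * b}) Q"
      unfolding disjoint_family_on_def
    proof (intro ballI impI)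
      fix m m' :: nat assume "m \<noteq> m'"
      have "k div b = m" if "k \<in> {m * b..<Suc m * b}" for k m :: nat
        using that by (intro div_nat_eqI) (auto simp: mult.commute)
      then show "{m * b..<Suc m * b} \<inter> {m' * b..<Suc m' * b} = {}" using \<open>m \<noteq> m'\<close> by blast
    qed
    then have card_T: "card (?T Q) = b * card Q"
      using Q_finite by (subst card_UN_disjoint') auto
    then have T_finite: "finite (?T Q)" "?T Q \<noteq> {}"
      using Q_finite b_ge_1 by (auto simp: card_gt_0_iff)
    have "(\<Inter>m\<in>Q. {\<omega>. \<not> good_block i b \<omega> m}) = (\<Inter>k\<in>?T Q. ?D k)" unfolding bad_eq by blast
    also have "P.prob \<dots> = (1 - pmf q i ^ 4) ^ card (?T Q)"
      by (rule prob_no_constant_quadruple[OF T_finite])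
    also have "\<dots> = ((1 - pmf q i ^ 4) ^ b) ^ card Q" unfolding card_T by (rule power_mult)
    finally show "P.prob (\<Inter>m\<in>Q. {\<omega>. \<not> good_block i b \<omega> m}) \<le> ((1 - pmf q i ^ 4) ^ b) ^ card Q"
      by simp
  qed (auto intro!: zero_le_power power_le_one simp: pmf_le_1)
  then show ?thesis by simp
qed

section \<open>Choice of the parameters\<close>

lemma exists_block_length:
  fixes A Y c x :: real
  assumes A_ge_1: "1 \<le> A" and Y_ge_1: "1 \<le> Y" and c_bounds: "0 < c" "c < 1"
    and x_bounds: "0 \<le> x" "x < 1"
  obtains b :: nat and \<kappa> where "1 \<le> b" "0 < \<kappa>" "2 * (x ^ b) powr \<kappa> < 1"
    "2 * (A * Y ^ b) powr (4 * \<kappa>) * c ^ (4 * b) \<le> 1 / 2"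
proof -
  define \<kappa> where "\<kappa> = - ln c / (4 * (ln Y + 1))"
  have ln_signs: "ln c < 0" "0 \<le> ln Y" using c_bounds Y_ge_1 by auto
  have \<kappa>_pos: "0 < \<kappa>" unfolding \<kappa>_def using ln_signs by (intro divide_pos_pos) auto
  have "4 * \<kappa> * ln Y = - ln c * (ln Y / (ln Y + 1))" using ln_signs by (simp add: \<kappa>_def field_simps)
  also have "\<dots> \<le> - ln c * 1" using ln_signs by (intro mult_left_mono) auto
  finally have "exp (4 * \<kappa> * ln Y) \<le> exp (- ln c)" by simp
  then have Y_powr: "Y powr (4 * \<kappa>) \<le> 1 / c"
    using Y_ge_1 c_bounds by (simp add: powr_def exp_minus inverse_eq_divide)
  have "Y powr (4 * \<kappa>) * c ^ 4 \<le> 1 / c * c ^ 4"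
    using Y_powr c_bounds by (intro mult_right_mono) auto
  also have "\<dots> = c ^ 3" using c_bounds by (simp add: eval_nat_numeral)
  also have "\<dots> < 1" using c_bounds by (simp add: power_less_one_iff)
  finally have "(\<lambda>b. 2 * A powr (4 * \<kappa>) * (Y powr (4 * \<kappa>) * c ^ 4) ^ b) \<longlonglongrightarrow> 2 * A powr (4 * \<kappa>) * 0"
    using c_bounds by (intro tendsto_intros LIMSEQ_power_zero) simp
  then have "\<forall>\<^sub>F b in sequentially. 2 * A powr (4 * \<kappa>) * (Y powr (4 * \<kappa>) * c ^ 4) ^ b < 1 / 2"
    by (rule order_tendstoD) simp
  moreover have "\<forall>\<^sub>F b in sequentially. 2 * (x powr \<kappa>) ^ b < 1"
  proof -
    have "x powr \<kappa> < 1" using x_bounds \<kappa>_pos by (cases "x = 0") (auto simp: powr01_less_one)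
    then have "(\<lambda>b. 2 * (x powr \<kappa>) ^ b) \<longlonglongrightarrow> 2 * 0" by (intro tendsto_intros LIMSEQ_power_zero) simp
    then show ?thesis by (rule order_tendstoD) simp
  qed
  ultimately have "\<forall>\<^sub>F b in sequentially. 1 \<le> b \<and> 2 * (x powr \<kappa>) ^ b < 1 \<and>
      2 * A powr (4 * \<kappa>) * (Y powr (4 * \<kappa>) * c ^ 4) ^ b < 1 / 2"
    using eventually_ge_at_top[of 1] by eventually_elim simp
  then obtain b where b_large: "1 \<le> b" "2 * (x powr \<kappa>) ^ b < 1"
    "2 * A powr (4 * \<kappa>) * (Y powr (4 * \<kappa>) * c ^ 4) ^ b < 1 / 2"
    unfolding eventually_sequentially by blast
  have "2 * (A * Y ^ b) powr (4 * \<kappa>) * c ^ (4 * b)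
      = 2 * A powr (4 * \<kappa>) * (Y powr (4 * \<kappa>) * c ^ 4) ^ b"
    using A_ge_1 Y_ge_1 b_large(1)
    by (simp add: powr_mult power_powr_commute power_mult_distrib power_mult)
  moreover have "2 * (x ^ b) powr \<kappa> < 1"
    using b_large(1,2) x_bounds by (simp add: power_powr_commute)
  ultimately show thesis using that[of b \<kappa>] b_large \<kappa>_pos by simp
qed

lemma (in exponent_region) exists_erdos_kahane:
  assumes \<rho>_bounds: "0 < \<rho>" "\<rho> \<le> 1"
  obtains b \<kappa> where "erdos_kahane \<beta> i0 V c L M \<delta> C b \<kappa>" "2 * ((1 - \<rho> ^ 4) ^ b) powr \<kappa> < 1"
proof -
  obtain A Y where growth: "1 \<le> A" "1 \<le> Y" "\<And>b. branching b \<le> A * Y ^ b"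
    by (rule branching_le_exponential) blast
  have "0 \<le> 1 - \<rho> ^ 4" "1 - \<rho> ^ 4 < 1" using \<rho>_bounds by (auto simp: power_le_one)
  then obtain b :: nat and \<kappa> where parameters: "1 \<le> b" "0 < \<kappa>" "2 * ((1 - \<rho> ^ 4) ^ b) powr \<kappa> < 1"
    "2 * (A * Y ^ b) powr (4 * \<kappa>) * c ^ (4 * b) \<le> 1 / 2"
    using exists_block_length[OF growth(1,2) c_bounds] by blast
  have "2 * branching b powr (4 * \<kappa>) * c ^ (4 * b) \<le> 2 * (A * Y ^ b) powr (4 * \<kappa>) * c ^ (4 * b)"
    using growth(3)[of b] branching_ge_1[of b] parameters(2) c_bounds
    by (intro mult_right_mono mult_left_mono powr_mono2) auto
  then have "erdos_kahane \<beta> i0 V c L M \<delta> C b \<kappa>"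
    using parameters(1,2,4) by unfold_locales auto
  then show thesis using parameters(3) by (rule that)
qed

lemma exp_inverse_lipschitz:
  fixes a z0 :: complex
  assumes in_V: "convex V" "s \<in> V" "s' \<in> V" and nonzero: "a \<noteq> 0" "z0 \<noteq> 0"
    and near: "\<And>s. s \<in> V \<Longrightarrow> cmod (exp (a * s) - z0) \<le> cmod z0 / 2"
  shows "cmod (s - s') \<le> 2 / (cmod a * cmod z0) * cmod (exp (a * s) - exp (a * s'))"
proof -
  define g where "g s = exp (a * s) - z0 * a * s" for s
  let ?B = "cmod a * cmod z0 / 2"
  have "cmod (g s - g s') \<le> ?B * cmod (s - s')"
  proof (rule field_differentiable_bound[OF in_V(1) _ _ in_V(2,3)])
    fix z assume z_in_V: "z \<in> V"
    show "(g has_field_derivative (exp (a * z) - z0) * a) (at z within V)"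
      unfolding g_def by (auto intro!: derivative_eq_intros simp: algebra_simps)
    show "cmod ((exp (a * z) - z0) * a) \<le> ?B"
      using mult_right_mono[OF near[OF z_in_V], of "cmod a"] by (simp add: norm_mult mult.commute)
  qed
  moreover have "z0 * a * (s - s') = (exp (a * s) - exp (a * s')) - (g s - g s')"
    by (simp add: g_def algebra_simps)
  then have "cmod (z0 * a * (s - s')) \<le> cmod (exp (a * s) - exp (a * s')) + cmod (g s - g s')"
    by (metis norm_triangle_ineq4)
  ultimately have "?B * cmod (s - s') \<le> cmod (exp (a * s) - exp (a * s'))"
    by (simp add: norm_mult mult.commute mult.left_commute)
  then show ?thesis using nonzero by (simp add: field_simps)
qed

definition admissible :: "('i \<Rightarrow> complex) \<Rightarrow> 'i \<Rightarrow> complex set" where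
  "admissible \<beta> i = {s. Re s < 0 \<and> (\<forall>j. Re (\<beta> j * s) < 0) \<and> Im (exp (\<beta> i * s)) \<noteq> 0}"

lemma admissible_ball:
  fixes \<beta> :: "'i::finite \<Rightarrow> complex"
  assumes "s0 \<in> admissible \<beta> i0"
  obtains r c L where "0 < r" "0 < c" "c < 1" "1 < L" "\<And>s. s \<in> ball s0 r \<Longrightarrow> Re s < 0"
    "\<And>s i. s \<in> ball s0 r \<Longrightarrow> cmod (exp (\<beta> i * s)) \<le> c"
    "\<And>s i. s \<in> ball s0 r \<Longrightarrow> cmod (exp (- \<beta> i * s)) \<le> L"
    "\<And>s. s \<in> ball s0 r \<Longrightarrow> cmod (exp (\<beta> i0 * s) - exp (\<beta> i0 * s0)) < \<bar>Im (exp (\<beta> i0 * s0))\<bar> / 2"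
proof -
  have s0_admissible: "Re s0 < 0" "\<And>i. Re (\<beta> i * s0) < 0" "Im (exp (\<beta> i0 * s0)) \<noteq> 0"
    using assms by (auto simp: admissible_def)
  define m where "m = Max (range (\<lambda>i. cmod (exp (\<beta> i * s0))))"
  define m' where "m' = Max (range (\<lambda>i. cmod (exp (- \<beta> i * s0))))"
  have norm_exp_le_m: "cmod (exp (\<beta> i * s0)) \<le> m" for i unfolding m_def by (rule Max_ge) auto
  have norm_exp_le_m': "cmod (exp (- \<beta> i * s0)) \<le> m'" for i unfolding m'_def by (rule Max_ge) auto
  have m_bounds: "0 < m" "m < 1" "0 < m'"
    using s0_admissible(2) less_le_trans[OF _ norm_exp_le_m] less_le_trans[OF _ norm_exp_le_m']
    by (auto simp: m_def norm_exp_eq_Re)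
  have exp_tendsto: "((\<lambda>s. exp (a * s)) \<longlongrightarrow> exp (a * s0)) (nhds s0)" for a
    by (intro tendsto_intros filterlim_ident)
  have "\<forall>\<^sub>F s in nhds s0. Re s < 0"
    by (rule order_tendstoD(2)[OF _ s0_admissible(1)]) (intro tendsto_intros filterlim_ident)
  moreover have "\<forall>\<^sub>F s in nhds s0. \<forall>i. cmod (exp (\<beta> i * s)) < (m + 1) / 2"
    using m_bounds(2) by (intro eventually_all_finite le_less_trans[OF norm_exp_le_m]
        order_tendstoD(2)[OF tendsto_norm[OF exp_tendsto]]) auto
  moreover have "\<forall>\<^sub>F s in nhds s0. \<forall>i. cmod (exp (- \<beta> i * s)) < m' + 1"
    by (intro eventually_all_finite le_less_trans[OF norm_exp_le_m']
        order_tendstoD(2)[OF tendsto_norm[OF exp_tendsto]]) auto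
  moreover have
    "\<forall>\<^sub>F s in nhds s0. cmod (exp (\<beta> i0 * s) - exp (\<beta> i0 * s0)) < \<bar>Im (exp (\<beta> i0 * s0))\<bar> / 2"
    using tendstoD[OF exp_tendsto, of "\<bar>Im (exp (\<beta> i0 * s0))\<bar> / 2" "\<beta> i0"] s0_admissible(3)
    by (simp add: dist_norm)
  ultimately have "\<forall>\<^sub>F s in nhds s0. Re s < 0 \<and> (\<forall>i. cmod (exp (\<beta> i * s)) < (m + 1) / 2) \<and>
      (\<forall>i. cmod (exp (- \<beta> i * s)) < m' + 1) \<and>
      cmod (exp (\<beta> i0 * s) - exp (\<beta> i0 * s0)) < \<bar>Im (exp (\<beta> i0 * s0))\<bar> / 2"
    by eventually_elim blast
  then obtain r
    where "0 < r" "\<And>s. dist s s0 < r \<Longrightarrow> Re s < 0 \<and> (\<forall>i. cmod (exp (\<beta> i * s)) < (m + 1) / 2) \<and>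
      (\<forall>i. cmod (exp (- \<beta> i * s)) < m' + 1) \<and>
      cmod (exp (\<beta> i0 * s) - exp (\<beta> i0 * s0)) < \<bar>Im (exp (\<beta> i0 * s0))\<bar> / 2"
    unfolding eventually_nhds_metric by blast
  then show thesis
    using m_bounds
    by (intro that[of r "(m + 1) / 2" "m' + 1"]) (auto simp: dist_commute intro: less_imp_le)
qed

lemma exists_exponent_region:
  fixes \<beta> :: "'i::finite \<Rightarrow> complex"
  assumes \<beta>_nonzero: "\<beta> i0 \<noteq> 0" and s0_admissible: "s0 \<in> admissible \<beta> i0"
  obtains V c L M \<delta> C where "open V" "s0 \<in> V" "exponent_region \<beta> i0 V c L M \<delta> C"
proof -
  let ?z0 = "exp (\<beta> i0 * s0)"
  obtain r c L where r_pos: "0 < r" and c_bounds: "0 < c" "c < 1" and L_gt_1: "1 < L"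
    and Re_neg: "\<And>s. s \<in> ball s0 r \<Longrightarrow> Re s < 0"
    and contraction: "\<And>s i. s \<in> ball s0 r \<Longrightarrow> cmod (exp (\<beta> i * s)) \<le> c"
    and expansion: "\<And>s i. s \<in> ball s0 r \<Longrightarrow> cmod (exp (- \<beta> i * s)) \<le> L"
    and near: "\<And>s. s \<in> ball s0 r \<Longrightarrow> cmod (exp (\<beta> i0 * s) - ?z0) < \<bar>Im ?z0\<bar> / 2"
    by (rule admissible_ball[OF s0_admissible]) blast
  have Im_z0_nonzero: "Im ?z0 \<noteq> 0" using s0_admissible by (simp add: admissible_def)
  have Im_near: "\<bar>Im (exp (\<beta> i0 * s)) - Im ?z0\<bar> < \<bar>Im ?z0\<bar> / 2" if "s \<in> ball s0 r" for s
    using near[OF that] abs_Im_le_cmod[of "exp (\<beta> i0 * s) - ?z0"] by simp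
  have "exponent_region \<beta> i0 (ball s0 r) c L (Max (range (\<lambda>i. cmod (\<beta> i)))) (\<bar>Im ?z0\<bar> / 2)
      (2 / (cmod (\<beta> i0) * cmod ?z0))"
  proof
    show "cmod (\<beta> i) \<le> Max (range (\<lambda>i. cmod (\<beta> i)))" for i by (rule Max_ge) auto
    show "\<bar>Im ?z0\<bar> / 2 \<le> \<bar>Im (exp (\<beta> i0 * s))\<bar>" if "s \<in> ball s0 r" for s
      using Im_near[OF that] by linarith
    show "0 < Im (exp (\<beta> i0 * s)) * Im (exp (\<beta> i0 * s'))"
      if "s \<in> ball s0 r" "s' \<in> ball s0 r" for s s'
      using Im_near[OF that(1)] Im_near[OF that(2)]
      by (auto simp: zero_less_mult_iff abs_if split: if_splits)
    show "cmod (s - s') \<le> 2 / (cmod (\<beta> i0) * cmod ?z0) * cmod (exp (\<beta> i0 * s) - exp (\<beta> i0 * s'))"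
      if "s \<in> ball s0 r" "s' \<in> ball s0 r" for s s'
    proof (rule exp_inverse_lipschitz[OF convex_ball that \<beta>_nonzero])
      show "cmod (exp (\<beta> i0 * s) - ?z0) \<le> cmod ?z0 / 2" if "s \<in> ball s0 r" for s
        using near[OF that] abs_Im_le_cmod[of ?z0] by linarith
    qed simp
  qed (use r_pos c_bounds L_gt_1 Re_neg contraction expansion Im_z0_nonzero \<beta>_nonzero in auto)
  then show thesis using r_pos by (intro that[of "ball s0 r"]) auto
qed

section \<open>The curves on which some power is real\<close>

text \<open>The branch cut of the logarithm is removed only to make the following set open, hence Borel.\<close>

definition nonreal_powers :: "('i \<Rightarrow> complex) \<Rightarrow> complex set" where
  "nonreal_powers \<beta> = {l \<in> ball 0 1 - \<real>\<^sub>\<le>\<^sub>0. \<forall>i. Im (l powr \<beta> i) \<noteq> 0}"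

lemma open_nonreal_powers:
  fixes \<beta> :: "'i::finite \<Rightarrow> complex"
  shows "open (nonreal_powers \<beta>)"
proof -
  let ?slit = "ball 0 1 - \<real>\<^sub>\<le>\<^sub>0 :: complex set"
  let ?S = "\<lambda>i. ?slit \<inter> (\<lambda>l. Im (l powr \<beta> i)) -` (- {0})"
  have "open (?S i)" for i
  proof (rule continuous_open_preimage)
    show "continuous_on ?slit (\<lambda>l. Im (l powr \<beta> i))"
      by (intro continuous_intros) (auto simp: complex_nonpos_Reals_iff)
  qed (auto intro: open_Diff closed_nonpos_Reals_complex)
  then have "open (\<Inter>i. ?S i)" by (intro open_INT) auto
  also have "(\<Inter>i. ?S i) = nonreal_powers \<beta>" by (auto simp: nonreal_powers_def)
  finally show ?thesis .
qed

lemma hausdorff_content_real_power_curve: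
  assumes \<beta>_nonzero: "\<beta> \<noteq> 0" and s_gt_1: "1 < s"
  shows "hausdorff_content s {l \<in> ball 0 1 - {0}. Im (l powr \<beta>) = 0} = 0"
proof -
  define line where "line k x = (complex_of_real x + \<i> * of_real (pi * of_int k)) / \<beta>" for k :: int
    and x
  have "(1 / cmod \<beta>)-lipschitz_on UNIV (line k)" for k
  proof (rule lipschitz_onI)
    fix x y
    have "line k x - line k y = of_real (x - y) / \<beta>"
      by (simp add: line_def diff_divide_distrib add_divide_distrib)
    then show "dist (line k x) (line k y) \<le> 1 / cmod \<beta> * dist x y"
      by (simp add: dist_norm norm_divide del: of_real_diff)
  qed simp
  then have "hausdorff_content s (\<Union>k. range (line k)) = 0"
    using s_gt_1 by (intro hausdorff_content_UN_eq_0
        hausdorff_content_lipschitz_image_eq_0[OF hausdorff_content_real_UNIV]) auto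
  then have "hausdorff_content s ((\<Union>k. range (line k)) \<inter> {z. Re z \<le> 0}) = 0"
    by (rule hausdorff_content_eq_0_subset) auto
  then have "hausdorff_content s (exp ` ((\<Union>k. range (line k)) \<inter> {z. Re z \<le> 0})) = 0"
    using s_gt_1 dist_exp_le_dist
    by (intro hausdorff_content_lipschitz_image_eq_0[where L = 1] lipschitz_onI) auto
  then show ?thesis
  proof (rule hausdorff_content_eq_0_subset, intro subsetI)
    fix l assume l_on_curve: "l \<in> {l \<in> ball 0 1 - {0}. Im (l powr \<beta>) = 0}"
    then have "l \<noteq> 0" "cmod l < 1" by auto
    then have "sin (Im (\<beta> * Ln l)) = 0" using l_on_curve by (simp add: powr_def Im_exp)
    then obtain k where Im_eq: "Im (\<beta> * Ln l) = of_int k * pi" by (auto simp: sin_zero_iff_int2)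
    have "\<beta> * Ln l = of_real (Re (\<beta> * Ln l)) + \<i> * of_real (pi * of_int k)"
      by (rule complex_eqI) (use Im_eq in auto)
    then have "Ln l = line k (Re (\<beta> * Ln l))" using \<beta>_nonzero by (simp add: line_def field_simps)
    moreover have "Re (Ln l) \<le> 0" using \<open>l \<noteq> 0\<close> \<open>cmod l < 1\<close> by simp
    moreover have "l = exp (Ln l)" using \<open>l \<noteq> 0\<close> by simp
    ultimately show "l \<in> exp ` ((\<Union>k. range (line k)) \<inter> {z. Re z \<le> 0})" by blast
  qed
qed

lemma hausdorff_content_nonpos_Reals:
  assumes "1 < s"
  shows "hausdorff_content s (\<real>\<^sub>\<le>\<^sub>0 :: complex set) = 0"
proof -
  have "1-lipschitz_on UNIV complex_of_real"
    by (rule lipschitz_onI) (auto simp: dist_norm simp flip: of_real_diff)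
  then have "hausdorff_content s (range complex_of_real) = 0"
    using assms by (intro hausdorff_content_lipschitz_image_eq_0 hausdorff_content_real_UNIV) auto
  then show ?thesis by (rule hausdorff_content_eq_0_subset) (auto simp: nonpos_Reals_def)
qed

lemma hausdorff_content_compl_nonreal_powers:
  fixes \<beta> :: "'i::finite \<Rightarrow> complex"
  assumes "\<And>i. \<beta> i \<noteq> 0" "1 < s"
  shows "hausdorff_content s (ball 0 1 - {0} - nonreal_powers \<beta>) = 0"
proof -
  have "hausdorff_content s (\<real>\<^sub>\<le>\<^sub>0 \<union> (\<Union>i. {l \<in> ball 0 1 - {0}. Im (l powr \<beta> i) = 0})) = 0"
    using assms by (intro hausdorff_content_Un_eq_0 hausdorff_content_UN_eq_0
        hausdorff_content_nonpos_Reals hausdorff_content_real_power_curve)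
      (auto simp: countable_finite)
  then show ?thesis
    by (rule hausdorff_content_eq_0_subset) (auto simp: nonreal_powers_def)
qed

section \<open>Exceptional sets of pairs\<close>

lemma sets_Omega_finite_prefix:
  fixes E :: "(nat \<Rightarrow> 'i::finite) \<Rightarrow> complex set"
  assumes closed: "\<And>\<omega>. closed (E \<omega>)"
    and prefix: "\<And>\<omega> \<omega>'. (\<And>j. j < R \<Longrightarrow> \<omega> j = \<omega>' j) \<Longrightarrow> E \<omega> = E \<omega>'"
  shows "{(\<omega>, l). l \<in> E \<omega>} \<in> sets (Omega_space \<Otimes>\<^sub>M borel)"
proof -
  let ?words = "{w :: 'i list. set w \<subseteq> UNIV \<and> length w = R}"
  let ?cylinder = "\<lambda>w :: 'i list. {\<omega> \<in> space Omega_space. \<forall>j\<in>{..<R}. \<omega> j = w ! j}"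
  have eq_cylinders: "{(\<omega>, l). l \<in> E \<omega>} = (\<Union>w\<in>?words. ?cylinder w \<times> E (\<lambda>j. w ! j))"
  proof (intro set_eqI iffI)
    fix x assume "x \<in> {(\<omega>, l). l \<in> E \<omega>}"
    then obtain \<omega> l where x_in: "x = (\<omega>, l)" "l \<in> E \<omega>" by auto
    let ?w = "map \<omega> [0..<R]"
    have "E \<omega> = E (\<lambda>j. ?w ! j)" by (rule prefix) simp
    then have "x \<in> ?cylinder ?w \<times> E (\<lambda>j. ?w ! j)"
      using x_in by (auto simp: Omega_space_def space_PiM)
    moreover have "?w \<in> ?words" by simp
    ultimately show "x \<in> (\<Union>w\<in>?words. ?cylinder w \<times> E (\<lambda>j. w ! j))" by blast
  next
    fix x assume "x \<in> (\<Union>w\<in>?words. ?cylinder w \<times> E (\<lambda>j. w ! j))"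
    then obtain w \<omega> l where x_in: "x = (\<omega>, l)" "\<And>j. j < R \<Longrightarrow> \<omega> j = w ! j" "l \<in> E (\<lambda>j. w ! j)" by auto
    have "E \<omega> = E (\<lambda>j. w ! j)" by (rule prefix) (rule x_in(2))
    then show "x \<in> {(\<omega>, l). l \<in> E \<omega>}" using x_in by simp
  qed
  have "?cylinder w \<in> sets Omega_space" for w
  proof (rule sets.sets_Collect_finite_All)
    fix j
    have "(\<lambda>\<omega>. \<omega> j) \<in> measurable (Omega_space :: (nat \<Rightarrow> 'i) measure) (count_space UNIV)"
      unfolding Omega_space_def by (rule measurable_component_singleton) simp
    from measurable_sets[OF this, of "{w ! j}"]
    show "{\<omega> \<in> space Omega_space. \<omega> j = w ! j} \<in> sets Omega_space"
      by (simp add: vimage_def Int_def conj_commute)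
  qed simp
  moreover have "finite ?words" by (rule finite_lists_length_eq) simp
  ultimately show ?thesis
    unfolding eq_cylinders using closed by (auto intro!: sets.finite_UN pair_measureI borel_closed)
qed

lemma sets_Omega_limsup:
  fixes E :: "(nat \<Rightarrow> 'i::finite) \<Rightarrow> nat \<Rightarrow> complex set"
  assumes "\<And>\<omega> N. closed (E \<omega> N)"
    and "\<And>\<omega> \<omega>' N. (\<And>j. j < R N \<Longrightarrow> \<omega> j = \<omega>' j) \<Longrightarrow> E \<omega> N = E \<omega>' N"
  shows "{(\<omega>, l). l \<in> limsup (E \<omega>)} \<in> sets (Omega_space \<Otimes>\<^sub>M borel)"
proof -
  have "{(\<omega>, l). l \<in> limsup (E \<omega>)} = (\<Inter>n. \<Union>N\<in>{n..}. {(\<omega>, l). l \<in> E \<omega> N})"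
    by (auto simp: limsup_INF_SUP)
  moreover have "{(\<omega>, l). l \<in> E \<omega> N} \<in> sets (Omega_space \<Otimes>\<^sub>M borel)" for N
    using assms by (rule sets_Omega_finite_prefix)
  ultimately show ?thesis by auto
qed

definition decays_at :: "('i \<Rightarrow> complex) \<Rightarrow> 'i \<Rightarrow> (nat \<Rightarrow> 'i) \<Rightarrow> complex \<Rightarrow> bool" where
  "decays_at \<beta> i \<omega> s \<longleftrightarrow> (\<forall>k t p j1 j2. planar_model k t p (\<lambda>j. exp (\<beta> j * s)) \<and>
     j1 < k i \<and> j2 < k i \<and> t i j1 \<noteq> t i j2 \<longrightarrow> eta k t p (\<lambda>j. exp (\<beta> j * s)) \<omega> \<in> D2)"

definition exceptional_set ::
  "('i \<Rightarrow> complex) \<Rightarrow> 'i pmf \<Rightarrow> 'i \<Rightarrow> complex set \<Rightarrow> ((nat \<Rightarrow> 'i) \<times> complex) set \<Rightarrow> bool" where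
  "exceptional_set \<beta> q i U B \<longleftrightarrow> B \<in> sets (Omega_space \<Otimes>\<^sub>M borel) \<and>
     (AE \<omega> in bernoulli_measure q. \<forall>s>1. hausdorff_content s (Pair \<omega> -` B) = 0) \<and>
     (\<forall>\<omega>. \<forall>s\<in>U. (\<omega>, exp s) \<notin> B \<longrightarrow> decays_at \<beta> i \<omega> s)"

lemma exceptional_set_subset:
  "exceptional_set \<beta> q i U B \<Longrightarrow> U' \<subseteq> U \<Longrightarrow> exceptional_set \<beta> q i U' B"
  by (auto simp: exceptional_set_def)

lemma exceptional_set_UN:
  assumes "countable D" "\<And>d. d \<in> D \<Longrightarrow> exceptional_set \<beta> q i (U d) (B d)"
  shows "exceptional_set \<beta> q i (\<Union>d\<in>D. U d) (\<Union>d\<in>D. B d)"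
proof -
  have "AE \<omega> in bernoulli_measure q. \<forall>d\<in>D. \<forall>s>1. hausdorff_content s (Pair \<omega> -` B d) = 0"
    using assms by (intro AE_ball_countable') (auto simp: exceptional_set_def)
  then have "AE \<omega> in bernoulli_measure q. \<forall>s>1. hausdorff_content s (Pair \<omega> -` (\<Union>d\<in>D. B d)) = 0"
    by eventually_elim (auto simp: vimage_UN intro: hausdorff_content_UN_eq_0[OF assms(1)])
  then show ?thesis
    using assms by (auto simp: exceptional_set_def intro!: sets.countable_UN'')
qed

lemma exists_local_exceptional_set:
  fixes \<beta> :: "'i::finite \<Rightarrow> complex"
  assumes \<beta>_nonzero: "\<beta> i \<noteq> 0" and q_pos: "0 < pmf q i" and s0_admissible: "s0 \<in> admissible \<beta> i"
  shows "\<exists>V B. open V \<and> s0 \<in> V \<and> exceptional_set \<beta> q i V B"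
proof -
  obtain V c L M \<delta> C where V_nhd: "open V" "s0 \<in> V" and region: "exponent_region \<beta> i V c L M \<delta> C"
    using exists_exponent_region[OF \<beta>_nonzero s0_admissible] by blast
  obtain b \<kappa> where "erdos_kahane \<beta> i V c L M \<delta> C b \<kappa>"
    and bad_rate: "2 * ((1 - pmf q i ^ 4) ^ b) powr \<kappa> < 1"
    using exponent_region.exists_erdos_kahane[OF region q_pos pmf_le_1] by blast
  then interpret erdos_kahane \<beta> i V c L M \<delta> C b \<kappa> by simp
  let ?B = "{(\<omega>, l). l \<in> limsup (exceptional \<omega>)}"
  have "?B \<in> sets (Omega_space \<Otimes>\<^sub>M borel)"
  proof (rule sets_Omega_limsup[where R = "\<lambda>N. 4 * b * N"])
    show "closed (exceptional \<omega> N)" for \<omega> N by (simp add: exceptional_def)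
  qed (rule exceptional_cong)
  moreover have
    "AE \<omega> in bernoulli_measure q. \<forall>s>1. hausdorff_content s (limsup (exceptional \<omega>)) = 0"
    using AE_few_bad_blocks[OF b_ge_1 \<kappa>_pos bad_rate]
    by eventually_elim (auto intro: limsup_exceptional_content_eq_0)
  moreover have "decays_at \<beta> i \<omega> s" if "s \<in> V" "exp s \<notin> limsup (exceptional \<omega>)" for \<omega> s
    unfolding decays_at_def using eta_in_D2[OF that] by blast
  ultimately have "exceptional_set \<beta> q i V ?B" by (simp add: exceptional_set_def vimage_def)
  then show ?thesis using V_nhd by blast
qed

lemma exists_exceptional_set:
  fixes \<beta> :: "'i::finite \<Rightarrow> complex"
  assumes "\<beta> i \<noteq> 0" "0 < pmf q i"
  shows "\<exists>B. exceptional_set \<beta> q i (admissible \<beta> i) B"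
proof -
  obtain V B where local_sets: "\<And>s. s \<in> admissible \<beta> i \<Longrightarrow>
      open (V s) \<and> s \<in> V s \<and> exceptional_set \<beta> q i (V s) (B s)"
    using exists_local_exceptional_set[where \<beta> = \<beta>, OF assms] by metis
  then have "\<And>S. S \<in> V ` admissible \<beta> i \<Longrightarrow> open S" by blast
  then obtain \<F> where subcover: "\<F> \<subseteq> V ` admissible \<beta> i" "countable \<F>" "\<Union>\<F> = \<Union>(V ` admissible \<beta> i)"
    by (rule Lindelof)
  then obtain D where D_countable: "countable D" "D \<subseteq> admissible \<beta> i" "\<F> = V ` D"
    using countable_subset_image by metis
  have "exceptional_set \<beta> q i (\<Union>s\<in>D. V s) (\<Union>s\<in>D. B s)"
    using D_countable local_sets by (intro exceptional_set_UN) auto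
  moreover have "admissible \<beta> i \<subseteq> (\<Union>s\<in>D. V s)" using subcover(3) D_countable(3) local_sets by blast
  ultimately show ?thesis by (blast intro: exceptional_set_subset)
qed

lemma measure_bernoulli_first_letter:
  "measure (bernoulli_measure q) {\<omega> \<in> space (bernoulli_measure q). \<omega> 0 = i} = pmf q i"
proof -
  have "distr (bernoulli_measure q) (measure_pmf q) (\<lambda>\<omega>. \<omega> 0) = measure_pmf q"
    unfolding bernoulli_measure_def
    by (rule distr_PiM_component) (auto intro: prob_space_measure_pmf)
  then have "pmf q i = measure (distr (bernoulli_measure q) (measure_pmf q) (\<lambda>\<omega>. \<omega> 0)) {i}"
    by (simp add: measure_pmf_single)
  also have "\<dots> = measure (bernoulli_measure q) {\<omega> \<in> space (bernoulli_measure q). \<omega> 0 = i}"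
    unfolding bernoulli_measure_def
    by (subst measure_distr) (auto intro!: arg_cong2[where f = measure])
  finally show ?thesis by simp
qed

lemma Ln_in_admissible:
  assumes "l \<in> nonreal_powers \<beta>" and model: "planar_model k t p (\<lambda>i. l powr \<beta> i)"
  shows "Ln l \<in> admissible \<beta> i"
proof -
  have l_nonreal: "l \<noteq> 0" "cmod l < 1" "Im (l powr \<beta> i) \<noteq> 0"
    using assms(1) by (auto simp: nonreal_powers_def)
  have "cmod (exp (\<beta> j * Ln l)) < 1" for j
    using model l_nonreal(1) by (simp add: planar_model_def powr_def)
  then have "Re (\<beta> j * Ln l) < 0" for j by (simp only: norm_exp_eq_Re exp_less_one_iff)
  then show ?thesis using l_nonreal by (simp add: admissible_def powr_def)
qed

lemma eta_in_D2_off_exceptional_sets: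
  assumes B_exceptional: "\<And>i. i \<in> set_pmf q \<Longrightarrow> exceptional_set \<beta> q i (admissible \<beta> i) (B i)"
    and l_off: "l \<in> nonreal_powers \<beta>" "(\<omega>, l) \<notin> (\<Union>i\<in>set_pmf q. B i)"
    and model: "planar_model k t p (\<lambda>i. l powr \<beta> i)" and "nondegenerate (bernoulli_measure q) k t"
  shows "eta k t p (\<lambda>i. l powr \<beta> i) \<omega> \<in> D2"
proof -
  obtain i j1 j2 where i_charged: "0 < pmf q i" and digits: "j1 < k i" "j2 < k i" "t i j1 \<noteq> t i j2"
    using assms(5) unfolding nondegenerate_def measure_bernoulli_first_letter by blast
  have "l \<noteq> 0" using l_off(1) by (auto simp: nonreal_powers_def)
  then have powr: "(\<lambda>j. l powr \<beta> j) = (\<lambda>j. exp (\<beta> j * Ln l))" and "exp (Ln l) = l"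
    by (auto simp: powr_def)
  moreover have "i \<in> set_pmf q" using i_charged by (simp add: set_pmf_iff)
  ultimately have "decays_at \<beta> i \<omega> (Ln l)"
    using B_exceptional[of i] l_off(2) Ln_in_admissible[OF l_off(1) model, of i]
    by (auto simp: exceptional_set_def)
  then show ?thesis using model digits unfolding decays_at_def powr by blast
qed

lemma AE_hausdorff_dim_off_exceptional_sets:
  fixes \<beta> :: "'i::finite \<Rightarrow> complex"
  assumes \<beta>_nonzero: "\<And>i. \<beta> i \<noteq> 0"
    and B_exceptional: "\<And>i. i \<in> set_pmf q \<Longrightarrow> exceptional_set \<beta> q i (U i) (B i)"
  shows "AE \<omega> in bernoulli_measure q. hausdorff_dim
      {l \<in> ball 0 1 - {0}. (\<omega>, l) \<notin> UNIV \<times> nonreal_powers \<beta> - (\<Union>i\<in>set_pmf q. B i)} \<le> 1"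
proof -
  have "AE \<omega> in bernoulli_measure q. \<forall>i\<in>set_pmf q. \<forall>s>1. hausdorff_content s (Pair \<omega> -` B i) = 0"
    using B_exceptional by (intro AE_ball_countable') (auto simp: exceptional_set_def)
  then show ?thesis
  proof eventually_elim
    case (elim \<omega>)
    let ?E = "{l \<in> ball 0 1 - {0}. (\<omega>, l) \<notin> UNIV \<times> nonreal_powers \<beta> - (\<Union>i\<in>set_pmf q. B i)}"
    have "hausdorff_content s ?E = 0" if "1 < s" for s
    proof -
      have "hausdorff_content s ((ball 0 1 - {0} - nonreal_powers \<beta>) \<union>
          (\<Union>i\<in>set_pmf q. Pair \<omega> -` B i)) = 0"
        using that elim \<beta>_nonzero by (intro hausdorff_content_Un_eq_0 hausdorff_content_UN_eq_0
            hausdorff_content_compl_nonreal_powers) auto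
      then show ?thesis by (rule hausdorff_content_eq_0_subset) auto
    qed
    then show ?case unfolding one_ereal_def by (intro hausdorff_dim_le) auto
  qed
qed

theorem theorem1p5:
  fixes \<beta> :: "'i::finite \<Rightarrow> complex" and q :: "'i pmf"
  assumes "\<forall>i. \<beta> i \<noteq> 0"
  shows "\<exists>G. G \<in> sets (Omega_space \<Otimes>\<^sub>M (borel :: complex measure)) \<and>
             G \<subseteq> UNIV \<times> ball 0 1 \<and>
             (AE \<omega> in bernoulli_measure q.
                hausdorff_dim {l \<in> ball 0 1 - {0}. (\<omega>, l) \<notin> G} \<le> 1) \<and>
             (\<forall>\<omega> l. (\<omega>, l) \<in> G \<longrightarrow>
                (\<forall>k t p. planar_model k t p (\<lambda>i. l powr \<beta> i) \<and>
                         nondegenerate (bernoulli_measure q) k t \<longrightarrow>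
                         eta k t p (\<lambda>i. l powr \<beta> i) \<omega> \<in> D2))"
proof -
  have "\<exists>B. exceptional_set \<beta> q i (admissible \<beta> i) B" if "i \<in> set_pmf q" for i
    using exists_exceptional_set[of \<beta> i q] assms that by (simp add: pmf_positive)
  then obtain B
    where B_exceptional: "\<And>i. i \<in> set_pmf q \<Longrightarrow> exceptional_set \<beta> q i (admissible \<beta> i) (B i)"
    by metis
  let ?B = "\<Union>i\<in>set_pmf q. B i"
  let ?G = "UNIV \<times> nonreal_powers \<beta> - ?B"
  have "UNIV \<in> sets (Omega_space :: (nat \<Rightarrow> 'i) measure)"
    using sets.top[of "Omega_space :: (nat \<Rightarrow> 'i) measure"] by (simp add: Omega_space_def space_PiM)
  then have "?G \<in> sets (Omega_space \<Otimes>\<^sub>M borel)"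
    using B_exceptional open_nonreal_powers
    by (intro sets.Diff pair_measureI sets.finite_UN borel_open) (auto simp: exceptional_set_def)
  moreover have "AE \<omega> in bernoulli_measure q. hausdorff_dim {l \<in> ball 0 1 - {0}. (\<omega>, l) \<notin> ?G} \<le> 1"
    using assms by (intro AE_hausdorff_dim_off_exceptional_sets[OF _ B_exceptional]) auto
  moreover have "?G \<subseteq> UNIV \<times> ball 0 1" by (auto simp: nonreal_powers_def)
  ultimately show ?thesis
    using eta_in_D2_off_exceptional_sets[OF B_exceptional] by (intro exI[of _ ?G]) auto
qed

end
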